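(* Let $\alpha=(\alpha_1,\ldots,\alpha_N)$ be positive integers with $\alpha_1>\ldots>\alpha_N$, let $\mu=(m_1,\ldots,m_N)$ be positive integers, and set $n:=2\sum_{r=1}^N\alpha_rm_r$. Let $\mathbb{T}^{\alpha,\mu}$ be the group described in the context (over $\mathbb{C}$). Fix $c\in\{1,2\}$ and define $$\mathcal{A}(\lambda):=\bigoplus_{r=1}^N\Big(\bigoplus_{j=1}^{m_r}\big(J_{\alpha_r}(\lambda)\oplus-(J_{\alpha_r}(\lambda))^T\big)\Big)\quad(\lambda\in\mathbb{C}\setminus\{0\}),\qquad \mathcal{R}(\widetilde\lambda):=e^{\mathcal{A}(\widetilde\lambda)}\quad(\widetilde\lambda\in\mathbb{C}\setminus\{ik\pi\}_{k\in\mathbb{Z}}),$$ $$H=\bigoplus_{r=1}^N\Big(\bigoplus_{j=1}^{m_r}\begin{bmatrix}0&I_{\alpha_r}\\(-1)^{c+1}I_{\alpha_r}&0\end{bmatrix}\Big),\qquad G=\begin{cases}\mathrm{O}_n(\mathbb{C},H),&c=1\\ \mathrm{Sp}_n(\mathbb{C},H),&c=2.\end{cases}$$ Then the isotropy group $\Sigma_G(\mathcal{A}(\lambda))=\{Q\in G\mid Q^{-1}\mathcal{A}(\lambda)Q=\mathcal{A}(\lambda)\}$ and the centralizer $\mathrm{C}_G(\mathcal{R}(\widetilde\lambda))=\{Q\in G\mid Q^{-1}\mathcal{R}(\widetilde\lambda)Q=\mathcal{R}(\widetilde\lambda)\}$ coincide for $\lambda=\widetilde\lambda\in\mathbb{C}\setminus\{ik\pi\}_{k\in\mathbb{Z}}$,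 and for $\lambda\in\mathbb{C}\setminus\{0\}$, $\widetilde\lambda\in\mathbb{C}\setminus\{ik\pi\}_{k\in\mathbb{Z}}$ they are both conjugate to the subgroup $$\mathbb{X}:=\{\mathcal{X}\oplus(\mathcal{X}^{-1})^T\mid\mathcal{X}\in\mathbb{T}^{\alpha,\mu}\}\subset\mathbb{T}^{\alpha,\mu}\oplus\mathbb{T}^{\alpha,\mu};\qquad \dim_{\mathbb{C}}(\mathbb{X})=\sum_{r=1}^Nm_r\Big(\alpha_rm_r+2\sum_{s=1}^{r-1}\alpha_sm_s\Big).$$
   Context: $J_m(\lambda)$ is the $m\times m$ upper triangular Jordan block with eigenvalue $\lambda$ and ones on the superdiagonal. For a nonsingular symmetric (resp. skew-symmetric) matrix $H$ of size $n$, $\mathrm{O}_n(\mathbb{C},H)$ (resp. $\mathrm{Sp}_n(\mathbb{C},H)$) is the group of $R\in\mathrm{GL}_n(\mathbb{C})$ with $R^THR=H$. Conjugacy is by a nonsingular complex matrix. For $A_0,\ldots,A_{b-1}$ of the same size, $T(A_0,\ldots,A_{b-1})$ is the $b\times b$ block upper triangular Toeplitz matrix with $(j,k)$ block $A_{k-j}$ for $k\ge j$ and $0$ for $k<j$. $\mathbb{T}^{\alpha,\mu}$ is the group of all nonsingular $N\times N$ block matrices $\mathcal{X}=[\mathcal{X}_{rs}]_{r,s=1}^N$ with $\mathcal{X}_{rs}$ an $\alpha_r\times\alpha_s$ block matrix of the form $$\mathcal{X}_{rs}=\begin{cases}[0\ \ \mathcal{T}_{rs}],&\alpha_r<\alpha_s\\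 \begin{bmatrix}\mathcal{T}_{rs}\\0\end{bmatrix},&\alpha_r>\alpha_s\\ \mathcal{T}_{rs},&\alpha_r=\alpha_s\end{cases},\qquad \mathcal{T}_{rs}=T(A_0^{rs},\ldots,A_{b_{rs}-1}^{rs}),\quad b_{rs}=\min\{\alpha_r,\alpha_s\},$$ with $A_j^{rs}\in\mathbb{C}^{m_r\times m_s}$ and $A_0^{rr}\in\mathrm{GL}_{m_r}(\mathbb{C})$.
   Formalization: The printed dimension is false (α=(2,1), μ=(1,1): 5, not 7); the inner sum is proved with α_r m_s instead of α_s m_s. The inclusion 𝕏⊂𝕋⊕𝕋 is false literally (N=1, α=2, m=1) and is proved after conjugating the second summand by a nonsingular matrix. *)

theory Defs
  imports
    "HOL-Analysis.Analysis"
    "Jordan_Normal_Form.Jordan_Normal_Form"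
begin

section \<open>Matrices and matrix groups\<close>

text \<open>The group of nonsingular complex matrices of size \<open>n\<close>; the inverse of a nonsingular matrix
  below is the inverse taken in this group.\<close>

definition GL :: "nat \<Rightarrow> complex mat monoid" where
  "GL n = units_of (ring_mat TYPE(complex) n ())"

abbreviation GL_inv :: "nat \<Rightarrow> complex mat \<Rightarrow> complex mat" where
  "GL_inv n P \<equiv> inv\<^bsub>GL n\<^esub> P"

text \<open>Meant for nonsingular symmetric \<open>H\<close> (orthogonal group) and nonsingular skew-symmetric \<open>H\<close>
  (symplectic group), respectively; the defining equation is the same.\<close>

definition O_group :: "nat \<Rightarrow> complex mat \<Rightarrow> complex mat set" where
  "O_group n H = {R \<in> carrier (GL n). R\<^sup>T * H * R = H}"

definition Sp_group :: "nat \<Rightarrow> complex mat \<Rightarrow> complex mat set" where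
  "Sp_group n H = {R \<in> carrier (GL n). R\<^sup>T * H * R = H}"

text \<open>The isotropy group is taken with respect to the action of \<open>G\<close> on matrices by conjugation;
  the formula for the centralizer is the same.\<close>

definition isotropy_group :: "nat \<Rightarrow> complex mat set \<Rightarrow> complex mat \<Rightarrow> complex mat set" where
  "isotropy_group n G A = {Q \<in> G. GL_inv n Q * A * Q = A}"

definition centralizer :: "nat \<Rightarrow> complex mat set \<Rightarrow> complex mat \<Rightarrow> complex mat set" where
  "centralizer n G R = {Q \<in> G. GL_inv n Q * R * Q = R}"

definition conj_image :: "nat \<Rightarrow> complex mat \<Rightarrow> complex mat set \<Rightarrow> complex mat set" where
  "conj_image n P S = (\<lambda>Q. GL_inv n P * Q * P) ` S"

definition conjugate_sets :: "nat \<Rightarrow> complex mat set \<Rightarrow> complex mat set \<Rightarrow> bool" where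
  "conjugate_sets n S S' \<longleftrightarrow> (\<exists>P \<in> carrier (GL n). S' = conj_image n P S)"

definition mat_exp :: "complex mat \<Rightarrow> complex mat" where
  "mat_exp A = Matrix.mat (dim_row A) (dim_col A)
     (\<lambda>ij. \<Sum>k. ((A ^\<^sub>m k) $$ ij) / fact k)"

definition dsum :: "complex mat \<Rightarrow> complex mat \<Rightarrow> complex mat" (infixr "\<oplus>\<^sub>m" 65) where
  "A \<oplus>\<^sub>m B = diag_block_mat [A, B]"

section \<open>Block matrices and the group of block Toeplitz type matrices\<close>

text \<open>\<open>block_pos ns i\<close> is \<open>(r, k)\<close> when \<open>i\<close> is the \<open>k\<close>-th index inside the \<open>r\<close>-th of consecutive
  intervals of lengths \<open>ns\<close>. All indices start from 0.\<close>

fun block_pos :: "nat list \<Rightarrow> nat \<Rightarrow> nat \<times> nat" where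
  "block_pos [] i = (0, i)"
| "block_pos (n # ns) i =
     (if i < n then (0, i) else (let (r, k) = block_pos ns (i - n) in (Suc r, k)))"

text \<open>The matrix with \<open>(r, s)\<close> block \<open>B r s\<close>, of size \<open>ns ! r\<close> times \<open>ms ! s\<close>.\<close>

definition block_mat :: "nat list \<Rightarrow> nat list \<Rightarrow> (nat \<Rightarrow> nat \<Rightarrow> complex mat) \<Rightarrow> complex mat" where
  "block_mat ns ms B = Matrix.mat (sum_list ns) (sum_list ms)
     (\<lambda>(i, j). let (r, k) = block_pos ns i; (s, l) = block_pos ms j in B r s $$ (k, l))"

text \<open>\<open>T(A 0, \<dots>, A (b - 1))\<close> with blocks \<open>A j\<close> of size \<open>p\<close> times \<open>q\<close>.\<close>

definition toeplitz :: "nat \<Rightarrow> nat \<Rightarrow> nat \<Rightarrow> (nat \<Rightarrow> complex mat) \<Rightarrow> complex mat" where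
  "toeplitz p q b A = block_mat (replicate b p) (replicate b q)
     (\<lambda>j k. if j \<le> k then A (k - j) else 0\<^sub>m p q)"

text \<open>An \<open>a\<close> times \<open>b\<close> block matrix with blocks of size \<open>p\<close> times \<open>q\<close>: zero columns are put
  to the left of, or zero rows below, a square block Toeplitz matrix.\<close>

definition padded_toeplitz ::
    "nat \<Rightarrow> nat \<Rightarrow> nat \<Rightarrow> nat \<Rightarrow> (nat \<Rightarrow> complex mat) \<Rightarrow> complex mat" where
  "padded_toeplitz a b p q A =
     (let T = toeplitz p q (min a b) A in
      if a < b then four_block_mat (0\<^sub>m (a * p) ((b - a) * q)) T
                      (0\<^sub>m 0 ((b - a) * q)) (0\<^sub>m 0 (a * q))
      else if b < a then T @\<^sub>r 0\<^sub>m ((a - b) * p) (b * q)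
      else T)"

definition half_dim :: "nat \<Rightarrow> (nat \<Rightarrow> nat) \<Rightarrow> (nat \<Rightarrow> nat) \<Rightarrow> nat" where
  "half_dim N \<alpha> m = (\<Sum>r<N. \<alpha> r * m r)"

definition TT :: "nat \<Rightarrow> (nat \<Rightarrow> nat) \<Rightarrow> (nat \<Rightarrow> nat) \<Rightarrow> complex mat set" where
  "TT N \<alpha> m = {X \<in> carrier (GL (half_dim N \<alpha> m)).
     \<exists>A :: nat \<Rightarrow> nat \<Rightarrow> nat \<Rightarrow> complex mat.
       (\<forall>r<N. \<forall>s<N. \<forall>j < min (\<alpha> r) (\<alpha> s). A r s j \<in> carrier_mat (m r) (m s)) \<and>
       (\<forall>r<N. A r r 0 \<in> carrier (GL (m r))) \<and>
       X = block_mat (map (\<lambda>r. \<alpha> r * m r) [0..<N]) (map (\<lambda>r. \<alpha> r * m r) [0..<N])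
             (\<lambda>r s. padded_toeplitz (\<alpha> r) (\<alpha> s) (m r) (m s) (A r s))}"

definition TT_dsum :: "nat \<Rightarrow> (nat \<Rightarrow> nat) \<Rightarrow> (nat \<Rightarrow> nat) \<Rightarrow> complex mat set" where
  "TT_dsum N \<alpha> m = {X \<oplus>\<^sub>m Y | X Y. X \<in> TT N \<alpha> m \<and> Y \<in> TT N \<alpha> m}"

definition XX :: "nat \<Rightarrow> (nat \<Rightarrow> nat) \<Rightarrow> (nat \<Rightarrow> nat) \<Rightarrow> complex mat set" where
  "XX N \<alpha> m = {X \<oplus>\<^sub>m (GL_inv (half_dim N \<alpha> m) X)\<^sup>T | X. X \<in> TT N \<alpha> m}"

section \<open>The normal forms\<close>

definition AA :: "nat \<Rightarrow> (nat \<Rightarrow> nat) \<Rightarrow> (nat \<Rightarrow> nat) \<Rightarrow> complex \<Rightarrow> complex mat" where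
  "AA N \<alpha> m z = diag_block_mat (map (\<lambda>r. diag_block_mat (replicate (m r)
     (jordan_block (\<alpha> r) z \<oplus>\<^sub>m - (jordan_block (\<alpha> r) z)\<^sup>T))) [0..<N])"

definition RR :: "nat \<Rightarrow> (nat \<Rightarrow> nat) \<Rightarrow> (nat \<Rightarrow> nat) \<Rightarrow> complex \<Rightarrow> complex mat" where
  "RR N \<alpha> m z = mat_exp (AA N \<alpha> m z)"

definition HH :: "nat \<Rightarrow> nat \<Rightarrow> (nat \<Rightarrow> nat) \<Rightarrow> (nat \<Rightarrow> nat) \<Rightarrow> complex mat" where
  "HH c N \<alpha> m = diag_block_mat (map (\<lambda>r. diag_block_mat (replicate (m r)
     (four_block_mat (0\<^sub>m (\<alpha> r) (\<alpha> r)) (1\<^sub>m (\<alpha> r))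
        ((-1) ^ (c + 1) \<cdot>\<^sub>m 1\<^sub>m (\<alpha> r)) (0\<^sub>m (\<alpha> r) (\<alpha> r))))) [0..<N])"

section \<open>Complex dimension\<close>

text \<open>For a finite index set \<open>I\<close>, \<open>cspace I\<close> is the space of complex tuples indexed by \<open>I\<close>,
  i.e. of functions that are \<open>undefined\<close> outside \<open>I\<close>.\<close>

definition cspace :: "'i set \<Rightarrow> ('i \<Rightarrow> complex) topology" where
  "cspace I = product_topology (\<lambda>_. euclidean) I"

text \<open>Holomorphic maps of several variables: continuous, and holomorphic in each variable
  separately.\<close>

definition holomorphic_map ::
    "'i set \<Rightarrow> 'j set \<Rightarrow> ('i \<Rightarrow> complex) set \<Rightarrow> (('i \<Rightarrow> complex) \<Rightarrow> ('j \<Rightarrow> complex)) \<Rightarrow> bool" where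
  "holomorphic_map I J U f \<longleftrightarrow>
     continuous_map (subtopology (cspace I) U) (cspace J) f \<and>
     (\<forall>z\<in>U. \<forall>i\<in>I. \<forall>j\<in>J. (\<lambda>t. f (z(i := t)) j) holomorphic_on {t. z(i := t) \<in> U})"

text \<open>\<open>M\<close> is an embedded complex submanifold of dimension \<open>d\<close>: near each of its points it is
  parametrized holomorphically by an open subset \<open>V\<close> of complex \<open>d\<close>-space. The holomorphic left
  inverse \<open>F\<close> makes the parametrization \<open>g\<close> an immersion and a homeomorphism onto its image.\<close>

definition complex_submanifold :: "'i set \<Rightarrow> nat \<Rightarrow> ('i \<Rightarrow> complex) set \<Rightarrow> bool" where
  "complex_submanifold I d M \<longleftrightarrow> M \<subseteq> topspace (cspace I) \<and>
     (\<forall>p\<in>M. \<exists>U V F g. openin (cspace I) U \<and> p \<in> U \<and> openin (cspace {..<d}) V \<and>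
        holomorphic_map I {..<d} U F \<and> holomorphic_map {..<d} I V g \<and>
        g ` V = M \<inter> U \<and> (\<forall>v\<in>V. F (g v) = v))"

definition mat_entries :: "nat \<Rightarrow> complex mat \<Rightarrow> nat \<times> nat \<Rightarrow> complex" where
  "mat_entries n A = restrict (\<lambda>ij. A $$ ij) ({..<n} \<times> {..<n})"

text \<open>The set \<open>S\<close> of matrices of size \<open>n\<close> has complex dimension \<open>d\<close>.\<close>

definition has_complex_dim :: "nat \<Rightarrow> complex mat set \<Rightarrow> nat \<Rightarrow> bool" where
  "has_complex_dim n S d \<longleftrightarrow>
     S \<subseteq> carrier_mat n n \<and> complex_submanifold ({..<n} \<times> {..<n}) d (mat_entries n ` S)"

end

theory Submission
  imports Defs
begin

text \<open>The normal form \<open>AA N \<alpha> m z\<close> and its exponential \<open>RR N \<alpha> m z\<close> have the same shape. Let \<open>N\<close> denote the direct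
  sum of the nilpotent Jordan blocks of sizes \<open>\<alpha> r\<close>, each taken \<open>m r\<close> times. One permutation of the
  basis vectors collects the Jordan blocks in the first half and their negative transposes in the
  second half, and it turns both matrices into \<open>f(N) \<oplus> g(N)\<^sup>T\<close> for power series \<open>f\<close> and \<open>g\<close>:
  \<open>f(t) = z + t\<close>, \<open>g(t) = - z - t\<close> for the normal form (\<open>reindex_AA\<close>) and \<open>f(t) = exp (z + t)\<close>,
  \<open>g(t) = exp (- z - t)\<close> for the exponential (\<open>reindex_RR\<close>). The same permutation turns the bilinear form
  into the standard one with blocks \<open>0\<close>, \<open>1\<close>, \<open>\<plusminus>1\<close>, \<open>0\<close> (\<open>reindex_HH\<close>).

  A matrix that commutes with \<open>f(N) \<oplus> g(N)\<^sup>T\<close> is block diagonal if \<open>f(0) \<noteq> g(0)\<close>, because the two summands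
  then have no common eigenvalue (\<open>commutant_block_diagonal\<close>). The condition is \<open>z \<noteq> 0\<close> for the normal form,
  and \<open>exp z \<noteq> exp (- z)\<close> for the exponential, which excludes the integer multiples of \<open>\<i> * pi\<close>. Its first
  block commutes with \<open>f(N)\<close>, and since \<open>f'(0) \<noteq> 0\<close> also with \<open>N\<close> (\<open>commutes_imp_toeplitz_like\<close>); the
  nonsingular matrices that commute with \<open>N\<close> are the block Toeplitz matrices of \<open>TT N \<alpha> m\<close> (\<open>TT_iff\<close>).
  Finally, preserving the bilinear form forces the second block to be the inverse transpose of the
  first. Hence both stabilizers become the set \<open>XX N \<alpha> m\<close> under the same permutation
  (\<open>stabilizer_eq_XX\<close>), so they coincide and are conjugate to it. Commutation with \<open>N\<close> is stable under
  products and inverses, which makes \<open>XX N \<alpha> m\<close> a group. Reversing every Jordan chain exchanges \<open>N\<close> and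
  \<open>N\<^sup>T\<close>, which conjugates the second components into \<open>TT N \<alpha> m\<close>.

  For the dimension, the free coefficients of the Toeplitz blocks are global coordinates of \<open>XX N \<alpha> m\<close>:
  they range over the open set where the determinant does not vanish, they are entries of the first
  component, and the entries of the inverse depend on them rationally
  (\<open>has_complex_dim_coordinate_pattern\<close>). Counting them gives the formula.\<close>

section \<open>Nonsingular matrices and their products\<close>

lemma GL_iff:
  "A \<in> carrier (GL n) \<longleftrightarrow> A \<in> carrier_mat n n \<and>
     (\<exists>B \<in> carrier_mat n n. A * B = 1\<^sub>m n \<and> B * A = 1\<^sub>m n)"
  unfolding GL_def units_of_def Units_def by (auto simp: ring_mat_simps)

lemma GL_group: "Group.group (GL n)"
proof -
  interpret ring "ring_mat TYPE(complex) n ()" by (rule ring_mat)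
  show ?thesis unfolding GL_def by (rule units_group)
qed

lemma GL_simps: "mult (GL n) = (*)" "one (GL n) = 1\<^sub>m n"
  unfolding GL_def units_of_def by (simp_all add: ring_mat_simps)

lemma GL_carrier: "A \<in> carrier (GL n) \<Longrightarrow> A \<in> carrier_mat n n"
  by (simp add: GL_iff)

lemma GL_inv:
  assumes "A \<in> carrier (GL n)"
  shows "GL_inv n A \<in> carrier (GL n)" "GL_inv n A \<in> carrier_mat n n"
    "A * GL_inv n A = 1\<^sub>m n" "GL_inv n A * A = 1\<^sub>m n"
proof -
  interpret Group.group "GL n" by (rule GL_group)
  show "GL_inv n A \<in> carrier (GL n)" using assms by simp
  then show "GL_inv n A \<in> carrier_mat n n" by (rule GL_carrier)
  show "A * GL_inv n A = 1\<^sub>m n" using r_inv[OF assms] by (simp add: GL_simps)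
  show "GL_inv n A * A = 1\<^sub>m n" using l_inv[OF assms] by (simp add: GL_simps)
qed

lemma GL_I:
  assumes "A \<in> carrier_mat n n" "B \<in> carrier_mat n n" "A * B = 1\<^sub>m n"
  shows "A \<in> carrier (GL n)" "B \<in> carrier (GL n)" "GL_inv n A = B" "GL_inv n B = A"
proof -
  interpret Group.group "GL n" by (rule GL_group)
  have BA: "B * A = 1\<^sub>m n" by (rule mat_mult_left_right_inverse[OF assms])
  show A: "A \<in> carrier (GL n)" and B: "B \<in> carrier (GL n)"
    using assms BA by (auto simp: GL_iff)
  show "GL_inv n A = B" by (rule inv_equality) (use A B BA in \<open>simp_all add: GL_simps\<close>)
  show "GL_inv n B = A" by (rule inv_equality) (use A B assms in \<open>simp_all add: GL_simps\<close>)
qed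

text \<open>Nonsingularity is an open condition on the entries, which makes the parameter domain of the
  chart of the group open.\<close>
lemma GL_iff_det:
  assumes "A \<in> carrier_mat n n"
  shows "A \<in> carrier (GL n) \<longleftrightarrow> Determinant.det A \<noteq> 0"
proof
  assume "A \<in> carrier (GL n)"
  then obtain B where "B \<in> carrier_mat n n" "A * B = 1\<^sub>m n" by (auto simp: GL_iff)
  with det_mult[OF assms this(1)] show "Determinant.det A \<noteq> 0" by auto
next
  assume nz: "Determinant.det A \<noteq> 0"
  have "A * (inverse (Determinant.det A) \<cdot>\<^sub>m adj_mat A) = 1\<^sub>m n"
    using adj_mat[OF assms] assms nz
    by (auto simp: mult_smult_distrib[of A n n _ n])
  then show "A \<in> carrier (GL n)"
    using GL_I(1)[OF assms] adj_mat(1)[OF assms] by (metis smult_carrier_mat)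
qed

text \<open>Cramer's rule: the entries of the inverse are rational functions of the entries, hence
  holomorphic in them.\<close>
lemma GL_inv_adj_mat:
  assumes "A \<in> carrier (GL n)"
  shows "GL_inv n A = inverse (Determinant.det A) \<cdot>\<^sub>m adj_mat A"
proof (rule GL_I(3))
  show A: "A \<in> carrier_mat n n" using assms by (rule GL_carrier)
  then have nz: "Determinant.det A \<noteq> 0" using assms GL_iff_det by blast
  show "inverse (Determinant.det A) \<cdot>\<^sub>m adj_mat A \<in> carrier_mat n n"
    using adj_mat(1)[OF A] by simp
  show "A * (inverse (Determinant.det A) \<cdot>\<^sub>m adj_mat A) = 1\<^sub>m n"
    using adj_mat[OF A] A nz
    by (auto simp: mult_smult_distrib[of A n n _ n])
qed

lemma GL_mult:
  assumes "A \<in> carrier (GL n)" "B \<in> carrier (GL n)"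
  shows "A * B \<in> carrier (GL n)" "GL_inv n (A * B) = GL_inv n B * GL_inv n A"
proof -
  interpret Group.group "GL n" by (rule GL_group)
  show "A * B \<in> carrier (GL n)" using m_closed[OF assms] by (simp add: GL_simps)
  show "GL_inv n (A * B) = GL_inv n B * GL_inv n A"
    using inv_mult_group[OF assms] by (simp add: GL_simps)
qed

lemma GL_transpose:
  assumes "A \<in> carrier (GL n)"
  shows "A\<^sup>T \<in> carrier (GL n)" "GL_inv n A\<^sup>T = (GL_inv n A)\<^sup>T"
proof -
  have "A\<^sup>T * (GL_inv n A)\<^sup>T = 1\<^sub>m n"
    using GL_inv[OF assms] GL_carrier[OF assms]
    by (metis transpose_mult transpose_one)
  then show "A\<^sup>T \<in> carrier (GL n)" "GL_inv n A\<^sup>T = (GL_inv n A)\<^sup>T"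
    using GL_I[of "A\<^sup>T" n "(GL_inv n A)\<^sup>T"] GL_inv[OF assms] GL_carrier[OF assms] by auto
qed

lemma GL_conj_fixes_iff_commutes:
  assumes Q: "Q \<in> carrier (GL n)" and B: "B \<in> carrier_mat n n"
  shows "GL_inv n Q * B * Q = B \<longleftrightarrow> B * Q = Q * B"
proof
  have Qc: "Q \<in> carrier_mat n n" using GL_carrier[OF Q] .
  note I = GL_inv[OF Q]
  {
    assume "GL_inv n Q * B * Q = B"
    then have "Q * B = Q * (GL_inv n Q * B * Q)" by simp
    also have "\<dots> = Q * (GL_inv n Q * (B * Q))"
      using Qc B I(2) by (simp add: assoc_mult_mat[of _ n n _ n _ n])
    also have "\<dots> = (Q * GL_inv n Q) * (B * Q)"
      using Qc B I(2) by (simp add: assoc_mult_mat[of _ n n _ n _ n])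
    also have "\<dots> = B * Q" using Qc B I by simp
    finally show "B * Q = Q * B" ..
  next
    assume *: "B * Q = Q * B"
    have "GL_inv n Q * B * Q = GL_inv n Q * (Q * B)"
      using Qc B I(2) * by (simp add: assoc_mult_mat[of _ n n _ n _ n])
    also have "\<dots> = (GL_inv n Q * Q) * B"
      using Qc B I(2) by (simp add: assoc_mult_mat[of _ n n _ n _ n])
    finally show "GL_inv n Q * B * Q = B" using B I by simp
  }
qed

lemma GL_commutes_inv:
  assumes Q: "Q \<in> carrier (GL n)" and B: "B \<in> carrier_mat n n" and c: "B * Q = Q * B"
  shows "B * GL_inv n Q = GL_inv n Q * B"
proof -
  have "GL_inv n Q * B * Q = B" using GL_conj_fixes_iff_commutes[OF Q B] c by simp
  then have "B * GL_inv n Q = (GL_inv n Q * B * Q) * GL_inv n Q" by simp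
  also have "\<dots> = (GL_inv n Q * B) * (Q * GL_inv n Q)"
    using GL_carrier[OF Q] B GL_inv(2)[OF Q] by (simp add: assoc_mult_mat[of _ n n _ n _ n])
  finally show ?thesis using B GL_inv[OF Q] by simp
qed

lemma mat_mult_index:
  assumes "A \<in> carrier_mat a n" "B \<in> carrier_mat n b" "i < a" "j < b"
  shows "(A * B) $$ (i, j) = (\<Sum>k<n. A $$ (i, k) * B $$ (k, j))"
  using assms unfolding times_mat_def scalar_prod_def by (auto simp: lessThan_atLeast0 intro!: sum.cong)

lemma dsum_four_block:
  assumes "A \<in> carrier_mat a a" "B \<in> carrier_mat b b"
  shows "A \<oplus>\<^sub>m B = four_block_mat A (0\<^sub>m a b) (0\<^sub>m b a) B"
  using assms unfolding dsum_def by (intro eq_matI) (auto simp: Let_def)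

lemma dsum_index:
  assumes "A \<in> carrier_mat a a" "B \<in> carrier_mat b b" "i < a + b" "j < a + b"
  shows "(A \<oplus>\<^sub>m B) $$ (i, j) = (if i < a then if j < a then A $$ (i, j) else 0
     else if j < a then 0 else B $$ (i - a, j - a))"
  using assms by (simp add: dsum_four_block[OF assms(1,2)])

lemma dsum_carrier:
  assumes "A \<in> carrier_mat a a" "B \<in> carrier_mat b b"
  shows "A \<oplus>\<^sub>m B \<in> carrier_mat (a + b) (a + b)"
  using assms by (simp add: dsum_four_block[OF assms])

lemma dsum_mult:
  assumes "A \<in> carrier_mat a a" "B \<in> carrier_mat b b" "C \<in> carrier_mat a a" "D \<in> carrier_mat b b"
  shows "(A \<oplus>\<^sub>m B) * (C \<oplus>\<^sub>m D) = (A * C) \<oplus>\<^sub>m (B * D)"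
proof -
  have "(A \<oplus>\<^sub>m B) * (C \<oplus>\<^sub>m D) = four_block_mat (A * C) (0\<^sub>m a b) (0\<^sub>m b a) (B * D)"
    unfolding dsum_four_block[OF assms(1,2)] dsum_four_block[OF assms(3,4)]
    using assms by (subst mult_four_block_mat[of _ a a _ b _ b _ _ a _ b]) auto
  then show ?thesis using assms by (simp add: dsum_four_block[of _ a _ b])
qed

lemma dsum_one: "1\<^sub>m a \<oplus>\<^sub>m 1\<^sub>m b = 1\<^sub>m (a + b)"
  by (simp add: dsum_four_block[of _ a _ b] four_block_one_mat)

lemma dsum_GL:
  assumes "A \<in> carrier (GL a)" "B \<in> carrier (GL b)"
  shows "A \<oplus>\<^sub>m B \<in> carrier (GL (a + b))"
    "GL_inv (a + b) (A \<oplus>\<^sub>m B) = GL_inv a A \<oplus>\<^sub>m GL_inv b B"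
proof -
  have "(A \<oplus>\<^sub>m B) * (GL_inv a A \<oplus>\<^sub>m GL_inv b B) = 1\<^sub>m (a + b)"
    using GL_inv[OF assms(1)] GL_inv[OF assms(2)] GL_carrier[OF assms(1)] GL_carrier[OF assms(2)]
    by (simp add: dsum_mult[of _ a _ b] dsum_one)
  note * = GL_I[OF dsum_carrier dsum_carrier this]
  show "A \<oplus>\<^sub>m B \<in> carrier (GL (a + b))"
    "GL_inv (a + b) (A \<oplus>\<^sub>m B) = GL_inv a A \<oplus>\<^sub>m GL_inv b B"
    using * GL_inv[OF assms(1)] GL_inv[OF assms(2)] GL_carrier[OF assms(1)] GL_carrier[OF assms(2)]
    by auto
qed

section \<open>Simultaneous permutation of rows and columns\<close>

definition reindex :: "nat \<Rightarrow> (nat \<Rightarrow> nat) \<Rightarrow> complex mat \<Rightarrow> complex mat" where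
  "reindex n \<pi> M = Matrix.mat n n (\<lambda>(i, j). M $$ (\<pi> i, \<pi> j))"

lemma reindex_carrier [simp]: "reindex n \<pi> M \<in> carrier_mat n n"
  by (simp add: reindex_def)

lemma reindex_index: "i < n \<Longrightarrow> j < n \<Longrightarrow> reindex n \<pi> M $$ (i, j) = M $$ (\<pi> i, \<pi> j)"
  by (simp add: reindex_def)

text \<open>Conjugation by a permutation matrix only renames indices. All conjugacies below come from
  such matrices, so they can be computed entry by entry.\<close>
lemma perm_matrix:
  assumes \<pi>: "bij_betw \<pi> {..<n} {..<n}"
  obtains P where "P \<in> carrier (GL n)"
    "\<And>M. M \<in> carrier_mat n n \<Longrightarrow> GL_inv n P * M * P = reindex n \<pi> M"
proof -
  define P :: "complex mat" where "P = Matrix.mat n n (\<lambda>(i, j). if i = \<pi> j then 1 else 0)"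
  have lt: "\<pi> i < n" if "i < n" for i using \<pi> that by (auto simp: bij_betw_def)
  have inj: "\<pi> i = \<pi> j \<longleftrightarrow> i = j" if "i < n" "j < n" for i j
    using \<pi> that by (auto simp: bij_betw_def inj_on_def)
  have P: "P \<in> carrier_mat n n" "P\<^sup>T \<in> carrier_mat n n" by (auto simp: P_def)
  have MP: "(M * P) $$ (i, j) = M $$ (i, \<pi> j)" if "M \<in> carrier_mat n n" "i < n" "j < n" for M i j
  proof -
    have "(M * P) $$ (i, j) = (\<Sum>k<n. M $$ (i, k) * P $$ (k, j))"
      using that P by (simp add: mat_mult_index[of _ n n _ n] del: index_mult_mat)
    also have "\<dots> = (\<Sum>k<n. if k = \<pi> j then M $$ (i, k) else 0)"
      using that by (intro sum.cong) (auto simp: P_def)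
    finally show ?thesis using lt[OF that(3)] by simp
  qed
  have PM: "(P\<^sup>T * M) $$ (i, j) = M $$ (\<pi> i, j)" if "M \<in> carrier_mat n n" "i < n" "j < n" for M i j
  proof -
    have "(P\<^sup>T * M) $$ (i, j) = (\<Sum>k<n. P\<^sup>T $$ (i, k) * M $$ (k, j))"
      using that P by (simp add: mat_mult_index[of _ n n _ n] del: index_mult_mat)
    also have "\<dots> = (\<Sum>k<n. if k = \<pi> i then M $$ (k, j) else 0)"
      using that by (intro sum.cong) (auto simp: P_def)
    finally show ?thesis using lt[OF that(2)] by simp
  qed
  have Pij: "P $$ (\<pi> i, j) = (if i = j then 1 else 0)" if "i < n" "j < n" for i j
    using that by (simp add: P_def lt inj)
  have "P\<^sup>T * P = 1\<^sub>m n"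
    by (rule eq_matI) (use P in \<open>auto simp: PM Pij simp del: index_mult_mat(1)\<close>)
  note I = GL_I[OF P(2,1) this]
  show thesis
  proof (rule that[OF I(2)])
    fix M :: "complex mat" assume M: "M \<in> carrier_mat n n"
    have "(GL_inv n P * M * P) $$ (i, j) = M $$ (\<pi> i, \<pi> j)" if "i < n" "j < n" for i j
      using MP[of "P\<^sup>T * M" i j] PM[OF M, of i "\<pi> j"] that lt M P by (simp add: I)
    then show "GL_inv n P * M * P = reindex n \<pi> M"
      using P M by (intro eq_matI) (auto simp: I reindex_def simp del: index_mult_mat(1))
  qed
qed

lemma reindex_mult:
  assumes \<pi>: "bij_betw \<pi> {..<n} {..<n}" and "A \<in> carrier_mat n n" "B \<in> carrier_mat n n"
  shows "reindex n \<pi> (A * B) = reindex n \<pi> A * reindex n \<pi> B"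
proof (rule eq_matI)
  have lt: "\<pi> i < n" if "i < n" for i using \<pi> that by (auto simp: bij_betw_def)
  fix i j assume "i < dim_row (reindex n \<pi> A * reindex n \<pi> B)"
    "j < dim_col (reindex n \<pi> A * reindex n \<pi> B)"
  then have ij: "i < n" "j < n" by (auto simp: reindex_def)
  have "reindex n \<pi> (A * B) $$ (i, j) = (\<Sum>k<n. A $$ (\<pi> i, k) * B $$ (k, \<pi> j))"
    using ij lt assms by (simp add: reindex_index mat_mult_index[of _ n n _ n] del: index_mult_mat)
  also have "\<dots> = (\<Sum>k<n. A $$ (\<pi> i, \<pi> k) * B $$ (\<pi> k, \<pi> j))"
    by (rule sum.reindex_bij_betw[OF \<pi>, symmetric])
  finally show "reindex n \<pi> (A * B) $$ (i, j) = (reindex n \<pi> A * reindex n \<pi> B) $$ (i, j)"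
    using ij by (simp add: reindex_index mat_mult_index[of _ n n _ n] del: index_mult_mat)
qed (simp_all add: reindex_def)

lemma reindex_transpose:
  assumes \<pi>: "bij_betw \<pi> {..<n} {..<n}" and "A \<in> carrier_mat n n"
  shows "reindex n \<pi> (A\<^sup>T) = (reindex n \<pi> A)\<^sup>T"
proof -
  have "\<pi> i < n" if "i < n" for i using \<pi> that by (auto simp: bij_betw_def)
  then show ?thesis using assms by (intro eq_matI) (auto simp: reindex_def)
qed

lemma reindex_one:
  assumes \<pi>: "bij_betw \<pi> {..<n} {..<n}"
  shows "reindex n \<pi> (1\<^sub>m n) = 1\<^sub>m n"
proof -
  have "\<pi> i < n" if "i < n" for i using \<pi> that by (auto simp: bij_betw_def)
  moreover have "\<pi> i = \<pi> j \<longleftrightarrow> i = j" if "i < n" "j < n" for i j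
    using \<pi> that by (auto simp: bij_betw_def inj_on_def)
  ultimately show ?thesis by (intro eq_matI) (auto simp: reindex_def)
qed

lemma reindex_inverse:
  assumes \<pi>: "bij_betw \<pi> {..<n} {..<n}" and M: "M \<in> carrier_mat n n"
  shows "reindex n (inv_into {..<n} \<pi>) (reindex n \<pi> M) = M"
    "reindex n \<pi> (reindex n (inv_into {..<n} \<pi>) M) = M"
proof -
  have "\<pi> i < n" if "i < n" for i using \<pi> that by (auto simp: bij_betw_def)
  moreover have "inv_into {..<n} \<pi> i < n" if "i < n" for i
    using bij_betw_inv_into[OF \<pi>] that by (auto simp: bij_betw_def)
  ultimately show "reindex n (inv_into {..<n} \<pi>) (reindex n \<pi> M) = M"
    "reindex n \<pi> (reindex n (inv_into {..<n} \<pi>) M) = M"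
    using M bij_betw_inv_into_left[OF \<pi>] bij_betw_inv_into_right[OF \<pi>]
    by (intro eq_matI; force simp: reindex_def)+
qed

lemma reindex_inject:
  assumes "bij_betw \<pi> {..<n} {..<n}" "A \<in> carrier_mat n n" "B \<in> carrier_mat n n"
  shows "reindex n \<pi> A = reindex n \<pi> B \<longleftrightarrow> A = B"
  using reindex_inverse(1)[OF assms(1)] assms(2,3) by metis

lemma reindex_GL:
  assumes \<pi>: "bij_betw \<pi> {..<n} {..<n}" and M: "M \<in> carrier_mat n n"
  shows "reindex n \<pi> M \<in> carrier (GL n) \<longleftrightarrow> M \<in> carrier (GL n)"
proof
  have *: "reindex n \<pi> M \<in> carrier (GL n)" if "bij_betw \<pi> {..<n} {..<n}" "M \<in> carrier (GL n)" for M \<pi>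
  proof (rule GL_I(1))
    show "reindex n \<pi> M * reindex n \<pi> (GL_inv n M) = 1\<^sub>m n"
      using GL_inv[OF that(2)] GL_carrier[OF that(2)] that(1)
      by (simp add: reindex_mult[symmetric] reindex_one)
  qed simp_all
  show "M \<in> carrier (GL n) \<Longrightarrow> reindex n \<pi> M \<in> carrier (GL n)" using * \<pi> by blast
  show "reindex n \<pi> M \<in> carrier (GL n) \<Longrightarrow> M \<in> carrier (GL n)"
    using *[OF bij_betw_inv_into[OF \<pi>]] reindex_inverse(1)[OF \<pi> M] by metis
qed

section \<open>Consecutive intervals of indices\<close>

definition offset :: "(nat \<Rightarrow> nat) \<Rightarrow> nat \<Rightarrow> nat" where
  "offset f r = (\<Sum>s<r. f s)"

lemma offset_0 [simp]: "offset f 0 = 0" by (simp add: offset_def)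
lemma offset_Suc: "offset f (Suc r) = offset f r + f r" by (simp add: offset_def)
lemma offset_const: "offset (\<lambda>_. M) a = a * M" by (simp add: offset_def)

lemma offset_mono: "r \<le> s \<Longrightarrow> offset f r \<le> offset f s"
  unfolding offset_def by (rule sum_mono2) auto

lemma offset_less:
  assumes "r < R" "k < f r" shows "offset f r + k < offset f R"
proof -
  have "offset f r + k < offset f (Suc r)" using assms by (simp add: offset_Suc)
  also have "\<dots> \<le> offset f R" using assms by (intro offset_mono) simp
  finally show ?thesis .
qed

text \<open>Distinct intervals are disjoint, so interval number and position in it are determined by the
  index.\<close>
lemma offset_eq_iff:
  assumes "k < f r" "l < f s"
  shows "offset f r + k = offset f s + l \<longleftrightarrow> r = s \<and> k = l"
  using offset_less[of r s k f] offset_less[of s r l f] assms by (cases r s rule: linorder_cases) auto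

lemma offset_ex:
  assumes "i < offset f R" obtains r k where "r < R" "k < f r" "i = offset f r + k"
proof -
  have "\<exists>r<R. \<exists>k<f r. i = offset f r + k" using assms
  proof (induction R)
    case (Suc R)
    show ?case
    proof (cases "i < offset f R")
      case True with Suc.IH show ?thesis by (metis less_Suc_eq)
    next
      case False
      then show ?thesis using Suc.prems by (intro exI[of _ R] conjI exI[of _ "i - offset f R"]) (auto simp: offset_Suc)
    qed
  qed simp
  then show thesis using that by blast
qed

lemma sum_offset: "(\<Sum>i<offset f R. F i) = (\<Sum>r<R. \<Sum>k<f r. F (offset f r + k))"
proof (induction R)
  case (Suc R)
  have "(\<Sum>i<offset f R + n. F i) = (\<Sum>i<offset f R. F i) + (\<Sum>k<n. F (offset f R + k))" for n
    by (induction n) (simp_all add: add.assoc)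
  then show ?case using Suc by (simp add: offset_Suc)
qed simp

text \<open>Intervals of equal length \<open>M\<close> give the usual row-major index \<open>k * M + l\<close>; this lemma and the
  next three specialize the previous ones to them.\<close>
lemma sum_prod_index: "(\<Sum>i<a * (M::nat). F i) = (\<Sum>k<a. \<Sum>l<M. F (k * M + l))"
  using sum_offset[where f = "\<lambda>_. M" and R = a and F = F] by (simp add: offset_const)

lemma prod_index_less: "k < a \<Longrightarrow> l < M \<Longrightarrow> k * M + l < a * (M::nat)"
  using offset_less[of k a l "\<lambda>_. M"] by (simp add: offset_const)

lemma prod_index_eq_iff: "k < M \<Longrightarrow> l < M \<Longrightarrow> a * M + k = b * M + l \<longleftrightarrow> a = b \<and> k = (l::nat)"
  using offset_eq_iff[of k "\<lambda>_. M" a l b] by (simp add: offset_const)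

lemma prod_index_ex:
  assumes "i < a * (M::nat)" obtains k l where "k < a" "l < M" "i = k * M + l"
  using offset_ex[of i "\<lambda>_. M" a] assms unfolding offset_const by metis

lemma block_pos_offset:
  assumes "r < R" "k < f r"
  shows "block_pos (map f [0..<R]) (offset f r + k) = (r, k)"
proof -
  have *: "block_pos ns (sum_list (take r ns) + k) = (r, k)" if "r < length ns" "k < ns ! r" for ns r
    using that
  proof (induction ns arbitrary: r)
    case (Cons n ns)
    show ?case
    proof (cases r)
      case 0 then show ?thesis using Cons by simp
    next
      case (Suc r')
      then have "block_pos ns (sum_list (take r' ns) + k) = (r', k)" using Cons by simp
      then show ?thesis using Suc by (simp add: add.assoc)
    qed
  qed simp
  have "sum_list (take r (map f [0..<R])) = offset f r"
    using assms by (simp add: take_map offset_def interv_sum_list_conv_sum_set_nat lessThan_atLeast0)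
  with *[of r "map f [0..<R]"] assms show ?thesis by simp
qed

lemma sum_list_map_offset: "sum_list (map f [0..<R]) = offset f R"
  by (simp add: offset_def interv_sum_list_conv_sum_set_nat lessThan_atLeast0)

lemma block_mat_carrier:
  "block_mat (map f [0..<R]) (map g [0..<S]) B \<in> carrier_mat (offset f R) (offset g S)"
  by (simp add: block_mat_def sum_list_map_offset)

lemma block_mat_offset:
  assumes "r < R" "k < f r" "s < S" "l < g s"
  shows "block_mat (map f [0..<R]) (map g [0..<S]) B $$ (offset f r + k, offset g s + l) = B r s $$ (k, l)"
  using offset_less[of r R k f] offset_less[of s S l g] assms
  by (simp add: block_mat_def sum_list_map_offset block_pos_offset)

lemma diag_block_mat_offset:
  assumes "\<And>r. r < R \<Longrightarrow> B r \<in> carrier_mat (f r) (f r)"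
  shows "diag_block_mat (map B [0..<R]) \<in> carrier_mat (offset f R) (offset f R) \<and>
    (\<forall>r<R. \<forall>s<R. \<forall>k<f r. \<forall>l<f s. diag_block_mat (map B [0..<R]) $$ (offset f r + k, offset f s + l) =
       (if r = s then B r $$ (k, l) else 0))"
  using assms
proof (induction R)
  case (Suc R)
  let ?D = "diag_block_mat (map B [0..<R])"
  have D: "?D \<in> carrier_mat (offset f R) (offset f R)"
    and IH: "\<And>r s k l. r < R \<Longrightarrow> s < R \<Longrightarrow> k < f r \<Longrightarrow> l < f s \<Longrightarrow>
      ?D $$ (offset f r + k, offset f s + l) = (if r = s then B r $$ (k, l) else 0)"
    using Suc by auto
  have B: "B R \<in> carrier_mat (f R) (f R)" using Suc by auto
  have eq: "diag_block_mat (map B [0..<Suc R]) =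
      four_block_mat ?D (0\<^sub>m (offset f R) (f R)) (0\<^sub>m (f R) (offset f R)) (B R)"
    using D B by (simp add: diag_block_mat_last Let_def)
  show ?case
  proof (intro conjI allI impI)
    show "diag_block_mat (map B [0..<Suc R]) \<in> carrier_mat (offset f (Suc R)) (offset f (Suc R))"
      unfolding eq using D B by (simp add: offset_Suc)
    fix r s k l assume *: "r < Suc R" "s < Suc R" "k < f r" "l < f s"
    show "diag_block_mat (map B [0..<Suc R]) $$ (offset f r + k, offset f s + l) =
        (if r = s then B r $$ (k, l) else 0)"
      unfolding eq using D B * offset_less[of r R k f] offset_less[of s R l f] IH[of r s k l]
      by (cases "r = R"; cases "s = R") (auto simp: less_Suc_eq)
  qed
qed simp

lemma diag_block_mat_offset_index:
  assumes "\<And>r. r < R \<Longrightarrow> B r \<in> carrier_mat (f r) (f r)" "r < R" "s < R" "k < f r" "l < f s"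
  shows "diag_block_mat (map B [0..<R]) $$ (offset f r + k, offset f s + l) = (if r = s then B r $$ (k, l) else 0)"
  using diag_block_mat_offset[of R B f] assms by blast

lemma replicate_eq_map: "replicate b x = map (\<lambda>_. x) [0..<b]"
  by (simp add: map_replicate_const)

lemma diag_block_mat_replicate:
  assumes B: "B \<in> carrier_mat M M"
  shows "diag_block_mat (replicate b B) \<in> carrier_mat (b * M) (b * M)"
    "\<lbrakk>i < b; j < b; k < M; l < M\<rbrakk> \<Longrightarrow>
       diag_block_mat (replicate b B) $$ (i * M + k, j * M + l) = (if i = j then B $$ (k, l) else 0)"
  using diag_block_mat_offset[of b "\<lambda>_. B" "\<lambda>_. M"] diag_block_mat_offset_index[of b "\<lambda>_. B" "\<lambda>_. M" i j k l] B
  by (simp_all add: replicate_eq_map offset_const)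

section \<open>Entries of block Toeplitz matrices\<close>

lemma toeplitz_carrier: "toeplitz p q b A \<in> carrier_mat (b * p) (b * q)"
  unfolding toeplitz_def replicate_eq_map
  using block_mat_carrier[of "\<lambda>_. p" b "\<lambda>_. q" b] by (simp add: offset_const)

lemma toeplitz_index:
  assumes "i < b" "j < b" "k < p" "l < q"
  shows "toeplitz p q b A $$ (i * p + k, j * q + l) = (if i \<le> j then A (j - i) $$ (k, l) else 0)"
  unfolding toeplitz_def replicate_eq_map
  using block_mat_offset[of i b k "\<lambda>_. p" j b l "\<lambda>_. q"] assms by (simp add: offset_const)

text \<open>Both kinds of padding are covered by one formula: zero columns on the left delay the diagonals
  by the truncated difference \<open>b - a\<close>, and zero rows below are automatic because a block Toeplitz
  matrix vanishes below its diagonal.\<close>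
lemma padded_toeplitz_index:
  assumes "i < a" "j < b" "k < p" "l < q"
  shows "padded_toeplitz a b p q A $$ (i * p + k, j * q + l) =
    (if i + (b - a) \<le> j then A (j - i - (b - a)) $$ (k, l) else 0)"
proof (cases a b rule: linorder_cases)
  case equal
  then show ?thesis using assms by (simp add: padded_toeplitz_def toeplitz_index)
next
  case less
  have T: "toeplitz p q a A \<in> carrier_mat (a * p) (a * q)" by (rule toeplitz_carrier)
  have 1: "i * p + k < a * p" using assms by (simp add: prod_index_less)
  have 2: "j * q + l < (b - a) * q + a * q"
    using prod_index_less[of j b l q] assms less by (simp add: add_mult_distrib[symmetric])
  show ?thesis
  proof (cases "j < b - a")
    case True
    then have "j * q + l < (b - a) * q" using assms by (simp add: prod_index_less)
    then show ?thesis using 1 2 T less True assms by (simp add: padded_toeplitz_def)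
  next
    case False
    then obtain j' where j: "j = (b - a) + j'" using le_Suc_ex by (metis not_less)
    have "\<not> j * q + l < (b - a) * q" by (simp add: j add_mult_distrib)
    moreover have "j * q + l - (b - a) * q = j' * q + l" by (simp add: j add_mult_distrib)
    moreover have "j' < a" using assms j less by simp
    ultimately show ?thesis using 1 2 T less assms j
      by (auto simp: padded_toeplitz_def toeplitz_index)
  qed
next
  case greater
  have T: "toeplitz p q b A \<in> carrier_mat (b * p) (b * q)" by (rule toeplitz_carrier)
  have 1: "i * p + k < b * p + (a - b) * p"
    using prod_index_less[of i a k p] assms greater by (simp add: add_mult_distrib[symmetric])
  have 2: "j * q + l < b * q" using assms by (simp add: prod_index_less)
  show ?thesis
  proof (cases "i < b")
    case True
    then have "i * p + k < b * p" using assms by (simp add: prod_index_less)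
    then show ?thesis using 1 2 T greater True assms
      by (simp add: padded_toeplitz_def append_rows_def toeplitz_index)
  next
    case False
    then obtain i' where i: "i = b + i'" using le_Suc_ex by (metis not_less)
    have "\<not> i * p + k < b * p" by (simp add: i add_mult_distrib)
    moreover have "i * p + k - b * p < (a - b) * p"
      using prod_index_less[of i' "a - b" k p] assms greater i by (simp add: add_mult_distrib)
    ultimately show ?thesis using 1 2 T greater assms False
      by (auto simp: padded_toeplitz_def append_rows_def)
  qed
qed

section \<open>Two orders of the basis vectors\<close>

text \<open>A basis vector of the space of dimension \<open>half_dim N \<alpha> m\<close> is a triple \<open>(r, a, p)\<close>: position \<open>a\<close> in
  the \<open>p\<close>-th of the \<open>m r\<close> Jordan chains of length \<open>\<alpha> r\<close>. The block Toeplitz matrices list these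
  triples with \<open>p\<close> running fastest. The normal forms list the chains one after another, and each
  chain (\<open>\<epsilon> = 0\<close>) is followed at once by its dual chain (\<open>\<epsilon> = 1\<close>).\<close>
locale block_sizes =
  fixes N :: nat and \<alpha> m :: "nat \<Rightarrow> nat"
begin

abbreviation h :: nat where "h \<equiv> half_dim N \<alpha> m"

definition valid :: "nat \<Rightarrow> nat \<Rightarrow> nat \<Rightarrow> bool" where
  "valid r a p \<longleftrightarrow> r < N \<and> a < \<alpha> r \<and> p < m r"

definition block_idx :: "nat \<Rightarrow> nat \<Rightarrow> nat \<Rightarrow> nat" where
  "block_idx r a p = offset (\<lambda>r. \<alpha> r * m r) r + (a * m r + p)"

definition chain_idx :: "nat \<Rightarrow> nat \<Rightarrow> nat \<Rightarrow> nat \<Rightarrow> nat" where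
  "chain_idx r p \<epsilon> a = offset (\<lambda>r. m r * (2 * \<alpha> r)) r + (p * (2 * \<alpha> r) + (\<epsilon> * \<alpha> r + a))"

definition block_coords :: "nat \<Rightarrow> nat \<times> nat \<times> nat" where
  "block_coords i = (let (r, k) = block_pos (map (\<lambda>r. \<alpha> r * m r) [0..<N]) i in (r, k div m r, k mod m r))"

lemma h_offset: "h = offset (\<lambda>r. \<alpha> r * m r) N"
  by (simp add: half_dim_def offset_def)

lemma double_h_offset: "2 * h = offset (\<lambda>r. m r * (2 * \<alpha> r)) N"
  by (simp add: half_dim_def offset_def sum_distrib_left mult.commute mult.left_commute)

lemma block_coords_block_idx: "valid r a p \<Longrightarrow> block_coords (block_idx r a p) = (r, a, p)"
  using prod_index_less[of a "\<alpha> r" p "m r"]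
  by (simp add: block_coords_def block_idx_def block_pos_offset valid_def)

lemma block_idx_less: "valid r a p \<Longrightarrow> block_idx r a p < h"
  unfolding block_idx_def h_offset by (rule offset_less) (auto simp: valid_def prod_index_less)

lemma block_idx_eq_iff: "valid r a p \<Longrightarrow> valid s b q \<Longrightarrow> block_idx r a p = block_idx s b q \<longleftrightarrow> r = s \<and> a = b \<and> p = q"
  using block_coords_block_idx[of r a p] block_coords_block_idx[of s b q] by (metis Pair_inject)

lemma block_idx_ex:
  assumes "i < h" obtains r a p where "valid r a p" "i = block_idx r a p"
proof -
  obtain r k where rk: "r < N" "k < \<alpha> r * m r" "i = offset (\<lambda>r. \<alpha> r * m r) r + k"
    using assms unfolding h_offset by (rule offset_ex)
  obtain a p where "a < \<alpha> r" "p < m r" "k = a * m r + p" using rk(2) by (rule prod_index_ex)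
  with rk show thesis by (intro that[of r a p]) (auto simp: valid_def block_idx_def)
qed

lemma sum_block_idx: "(\<Sum>i<h. F i) = (\<Sum>r<N. \<Sum>a<\<alpha> r. \<Sum>p<m r. F (block_idx r a p))"
  unfolding h_offset by (simp add: sum_offset sum_prod_index block_idx_def)

lemma mat_eqI_block_idx:
  assumes "A \<in> carrier_mat h h" "B \<in> carrier_mat h h"
    and "\<And>r a p s b q. valid r a p \<Longrightarrow> valid s b q \<Longrightarrow> A $$ (block_idx r a p, block_idx s b q) = B $$ (block_idx r a p, block_idx s b q)"
  shows "A = B"
proof (rule eq_matI)
  fix i j assume "i < dim_row B" "j < dim_col B"
  then have ij: "i < h" "j < h" using assms by auto
  obtain r a p where "valid r a p" "i = block_idx r a p" using ij(1) by (rule block_idx_ex)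
  moreover obtain s b q where "valid s b q" "j = block_idx s b q" using ij(2) by (rule block_idx_ex)
  ultimately show "A $$ (i, j) = B $$ (i, j)" using assms(3) by blast
qed (use assms in auto)

lemma chain_idx_inner_less: "\<epsilon> < 2 \<Longrightarrow> a < \<alpha> r \<Longrightarrow> \<epsilon> * \<alpha> r + a < 2 * \<alpha> r"
  by (rule prod_index_less)

lemma chain_idx_less:
  assumes "valid r a p" "\<epsilon> < 2" shows "chain_idx r p \<epsilon> a < 2 * h"
  unfolding chain_idx_def double_h_offset
  by (rule offset_less) (use assms in \<open>auto simp: valid_def intro!: prod_index_less chain_idx_inner_less\<close>)

lemma chain_idx_eq_iff:
  assumes "valid r a p" "\<epsilon> < 2" "valid s b q" "\<delta> < 2"
  shows "chain_idx r p \<epsilon> a = chain_idx s q \<delta> b \<longleftrightarrow> r = s \<and> p = q \<and> \<epsilon> = \<delta> \<and> a = b"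
proof -
  have "chain_idx r p \<epsilon> a = chain_idx s q \<delta> b \<longleftrightarrow>
      r = s \<and> p * (2 * \<alpha> r) + (\<epsilon> * \<alpha> r + a) = q * (2 * \<alpha> s) + (\<delta> * \<alpha> s + b)"
    unfolding chain_idx_def
    by (rule offset_eq_iff) (use assms in \<open>auto simp: valid_def intro!: prod_index_less chain_idx_inner_less\<close>)
  moreover have "p * (2 * \<alpha> r) + (\<epsilon> * \<alpha> r + a) = q * (2 * \<alpha> r) + (\<delta> * \<alpha> r + b) \<longleftrightarrow>
      p = q \<and> \<epsilon> * \<alpha> r + a = \<delta> * \<alpha> r + b" if "r = s"
    by (rule prod_index_eq_iff) (use assms that in \<open>auto simp: valid_def intro!: chain_idx_inner_less\<close>)
  moreover have "\<epsilon> * \<alpha> r + a = \<delta> * \<alpha> r + b \<longleftrightarrow> \<epsilon> = \<delta> \<and> a = b" if "r = s"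
    by (rule prod_index_eq_iff) (use assms that in \<open>auto simp: valid_def\<close>)
  ultimately show ?thesis by auto
qed

text \<open>The permutation that passes from the order of the normal forms to the order in which all
  chains come first, in block Toeplitz order, and all dual chains last.\<close>
definition reorder :: "nat \<Rightarrow> nat" where
  "reorder i = (let (r, a, p) = block_coords (i mod h) in chain_idx r p (i div h) a)"

lemma reorder_block_idx:
  assumes "valid r a p"
  shows "reorder (block_idx r a p) = chain_idx r p 0 a" "reorder (h + block_idx r a p) = chain_idx r p 1 a"
  using block_idx_less[OF assms] block_coords_block_idx[OF assms] by (simp_all add: reorder_def)

lemma double_h_ex:
  assumes "i < 2 * h"
  obtains r a p where "valid r a p" "i = block_idx r a p" | r a p where "valid r a p" "i = h + block_idx r a p"
proof (cases "i < h")
  case True then show ?thesis using that(1) by (rule block_idx_ex)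
next
  case False
  then have "i - h < h" "i = h + (i - h)" using assms by auto
  then show ?thesis using that(2) by (metis block_idx_ex)
qed

lemma reorder_bij: "bij_betw reorder {..<2 * h} {..<2 * h}"
proof -
  have dec: "\<exists>r a p \<epsilon>. valid r a p \<and> \<epsilon> < 2 \<and> i = \<epsilon> * h + block_idx r a p \<and> reorder i = chain_idx r p \<epsilon> a"
    if "i < 2 * h" for i
    using that
  proof (cases rule: double_h_ex)
    case (1 r a p)
    then show ?thesis by (intro exI[of _ r] exI[of _ a] exI[of _ p] exI[of _ 0]) (simp add: reorder_block_idx)
  next
    case (2 r a p)
    then show ?thesis by (intro exI[of _ r] exI[of _ a] exI[of _ p] exI[of _ 1]) (simp add: reorder_block_idx)
  qed
  have "inj_on reorder {..<2 * h}"
  proof (rule inj_onI)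
    fix i j assume "i \<in> {..<2 * h}" "j \<in> {..<2 * h}" "reorder i = reorder j"
    then show "i = j" using dec[of i] dec[of j] chain_idx_eq_iff by (metis lessThan_iff)
  qed
  moreover have "reorder ` {..<2 * h} \<subseteq> {..<2 * h}"
    using dec chain_idx_less by (metis image_subsetI lessThan_iff)
  ultimately show ?thesis by (simp add: bij_betw_def endo_inj_surj)
qed

text \<open>Chains and dual chains become the two halves of the index range.\<close>
lemma reindex_reorder_four_block:
  assumes car: "A \<in> carrier_mat h h" "B \<in> carrier_mat h h" "C \<in> carrier_mat h h" "D \<in> carrier_mat h h"
    and "\<And>r a p s b q. valid r a p \<Longrightarrow> valid s b q \<Longrightarrow>
        M $$ (chain_idx r p 0 a, chain_idx s q 0 b) = A $$ (block_idx r a p, block_idx s b q) \<and>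
        M $$ (chain_idx r p 0 a, chain_idx s q 1 b) = B $$ (block_idx r a p, block_idx s b q) \<and>
        M $$ (chain_idx r p 1 a, chain_idx s q 0 b) = C $$ (block_idx r a p, block_idx s b q) \<and>
        M $$ (chain_idx r p 1 a, chain_idx s q 1 b) = D $$ (block_idx r a p, block_idx s b q)"
  shows "reindex (2 * h) reorder M = four_block_mat A B C D"
proof (rule eq_matI)
  fix i j assume "i < dim_row (four_block_mat A B C D)" "j < dim_col (four_block_mat A B C D)"
  then have ij: "i < 2 * h" "j < 2 * h" using car by auto
  have "reindex (2 * h) reorder M $$ (i, j) = M $$ (reorder i, reorder j)"
    using ij by (simp add: reindex_index)
  also have "\<dots> = four_block_mat A B C D $$ (i, j)"
  proof (cases rule: double_h_ex[OF ij(1)]; cases rule: double_h_ex[OF ij(2)])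
  qed (use car assms(5) block_idx_less trans_less_add1[OF block_idx_less, of _ _ _ h] reorder_block_idx in simp_all)
  finally show "reindex (2 * h) reorder M $$ (i, j) = four_block_mat A B C D $$ (i, j)" .
qed (use car in \<open>simp_all add: reindex_def\<close>)

lemma nested_diag:
  assumes "\<And>r. D r \<in> carrier_mat (2 * \<alpha> r) (2 * \<alpha> r)"
  shows "diag_block_mat (map (\<lambda>r. diag_block_mat (replicate (m r) (D r))) [0..<N]) \<in> carrier_mat (2 * h) (2 * h)"
    "\<lbrakk>valid r a p; \<epsilon> < 2; valid s b q; \<delta> < 2\<rbrakk> \<Longrightarrow>
       diag_block_mat (map (\<lambda>r. diag_block_mat (replicate (m r) (D r))) [0..<N]) $$ (chain_idx r p \<epsilon> a, chain_idx s q \<delta> b) =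
         (if r = s \<and> p = q then D r $$ (\<epsilon> * \<alpha> r + a, \<delta> * \<alpha> r + b) else 0)"
proof -
  let ?f = "\<lambda>r. m r * (2 * \<alpha> r)"
  let ?B = "\<lambda>r. diag_block_mat (replicate (m r) (D r))"
  have car: "?B r \<in> carrier_mat (?f r) (?f r)" for r
    using diag_block_mat_replicate(1)[OF assms] .
  then show "diag_block_mat (map ?B [0..<N]) \<in> carrier_mat (2 * h) (2 * h)"
    unfolding double_h_offset using diag_block_mat_offset[of N ?B ?f] by blast
  assume *: "valid r a p" "\<epsilon> < 2" "valid s b q" "\<delta> < 2"
  have "diag_block_mat (map ?B [0..<N]) $$ (chain_idx r p \<epsilon> a, chain_idx s q \<delta> b) =
      (if r = s then ?B r $$ (p * (2 * \<alpha> r) + (\<epsilon> * \<alpha> r + a), q * (2 * \<alpha> s) + (\<delta> * \<alpha> s + b)) else 0)"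
    unfolding chain_idx_def
    by (rule diag_block_mat_offset_index[OF car])
      (use * in \<open>auto simp: valid_def intro!: prod_index_less chain_idx_inner_less\<close>)
  also have "\<dots> = (if r = s \<and> p = q then D r $$ (\<epsilon> * \<alpha> r + a, \<delta> * \<alpha> r + b) else 0)"
    using diag_block_mat_replicate(2)[OF assms, of p "m r" q "\<epsilon> * \<alpha> r + a" r "\<delta> * \<alpha> r + b"] *
    by (auto simp: valid_def chain_idx_inner_less)
  finally show "diag_block_mat (map ?B [0..<N]) $$ (chain_idx r p \<epsilon> a, chain_idx s q \<delta> b) =
     (if r = s \<and> p = q then D r $$ (\<epsilon> * \<alpha> r + a, \<delta> * \<alpha> r + b) else 0)" .
qed

end

section \<open>Intertwiners of triangular Toeplitz matrices\<close>

text \<open>Constant along diagonals, zero below the main diagonal, and, if there are more columns than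
  rows, zero on the first \<open>L - K\<close> diagonals: the form of a matrix that intertwines nilpotent Jordan
  blocks of sizes \<open>K\<close> and \<open>L\<close>.\<close>
definition toeplitz_like :: "nat \<Rightarrow> nat \<Rightarrow> (nat \<Rightarrow> nat \<Rightarrow> complex) \<Rightarrow> bool" where
  "toeplitz_like K L x \<longleftrightarrow>
     (\<forall>a<K. \<forall>b<L. x a b = (if a + (L - K) \<le> b then x 0 (b - a) else 0))"

context
  fixes K L :: nat and x :: "nat \<Rightarrow> nat \<Rightarrow> complex"
begin

text \<open>Shifts of the finite array \<open>x\<close> leave its index range, so it is continued by zero; the
  column index is an integer because it is shifted to the left, past column 0.\<close>
private definition ext :: "nat \<Rightarrow> int \<Rightarrow> complex" where
  "ext a b = (if a < K \<and> 0 \<le> b \<and> b < int L then x a (nat b) else 0)"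

text \<open>The entry of \<open>N x - x N\<close> at \<open>(a, b)\<close> for nilpotent Jordan blocks \<open>N\<close>: left multiplication
  by \<open>N\<close> moves the rows up and right multiplication moves the columns to the right.\<close>
private definition defect :: "nat \<Rightarrow> int \<Rightarrow> complex" where
  "defect a b = ext (Suc a) b - ext a (b - 1)"

text \<open>The products of \<open>f(N)\<close> with \<open>x\<close> from the left and, in the next lemma, from the right become
  sums over shifts. The common range \<open>d < K + L\<close> contains every shift that meets the array, and it
  contains \<open>d = 1\<close> even when \<open>K = L = 1\<close>.\<close>
private lemma row_sum:
  assumes "a < K" "b < L"
  shows "(\<Sum>a'<K. (if a \<le> a' then f (a' - a) else 0) * x a' b) =
    (\<Sum>d<K + L. f d * ext (a + d) (int b))"
proof -
  have "(\<Sum>a'<K. (if a \<le> a' then f (a' - a) else 0) * x a' b) = (\<Sum>a'\<in>{a..<K}. f (a' - a) * x a' b)"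
    by (rule sum.mono_neutral_cong_right) auto
  also have "\<dots> = (\<Sum>d<K - a. f d * x (a + d) b)"
    using assms by (intro sum.reindex_bij_witness[of _ "\<lambda>d. a + d" "\<lambda>a'. a' - a"]) auto
  also have "\<dots> = (\<Sum>d<K + L. f d * ext (a + d) (int b))"
    by (rule sum.mono_neutral_cong_left) (use assms in \<open>auto simp: ext_def\<close>)
  finally show ?thesis .
qed

private lemma column_sum:
  assumes "a < K" "b < L"
  shows "(\<Sum>b'<L. x a b' * (if b' \<le> b then f (b - b') else 0)) =
    (\<Sum>d<K + L. f d * ext a (int b - int d))"
proof -
  have "(\<Sum>b'<L. x a b' * (if b' \<le> b then f (b - b') else 0)) = (\<Sum>b'\<in>{..b}. f (b - b') * x a b')"
    by (rule sum.mono_neutral_cong_right) (use assms in auto)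
  also have "\<dots> = (\<Sum>d\<in>{..b}. f d * x a (b - d))"
    using assms by (intro sum.reindex_bij_witness[of _ "\<lambda>d. b - d" "\<lambda>d. b - d"]) auto
  also have "\<dots> = (\<Sum>d<K + L. f d * ext a (int b - int d))"
    by (rule sum.mono_neutral_cong_left) (use assms in \<open>auto simp: ext_def nat_diff_distrib'\<close>)
  finally show ?thesis .
qed

text \<open>This is the identity \<open>S\<^sup>d - T\<^sup>d = (\<Sum>i<d. S\<^sup>i T\<^bsup>d - 1 - i\<^esup>) (S - T)\<close> for the commuting shifts \<open>S\<close>
  (rows) and \<open>T\<close> (columns); so the commutator of \<open>f(N)\<close> is expressed by that of \<open>N\<close>.\<close>
private lemma telescope:
  "ext (a + d) b - ext a (b - int d) = (\<Sum>i<d. defect (a + i) (b - (int d - 1 - int i)))"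
proof -
  have "(\<Sum>i<d. defect (a + i) (b - (int d - 1 - int i))) =
      (\<Sum>i<d. ext (a + Suc i) (b - (int d - int (Suc i))) - ext (a + i) (b - (int d - int i)))"
    by (rule sum.cong) (simp_all add: defect_def algebra_simps)
  also have "\<dots> = ext (a + d) (b - (int d - int d)) - ext (a + 0) (b - (int d - int 0))"
    by (rule sum_lessThan_telescope)
  finally show ?thesis by simp
qed

private lemma sums_eq_iff:
  assumes "a < K" "b < L"
  shows "(\<Sum>a'<K. (if a \<le> a' then f (a' - a) else 0) * x a' b) =
      (\<Sum>b'<L. x a b' * (if b' \<le> b then f (b - b') else 0)) \<longleftrightarrow>
    (\<Sum>d<K + L. f d * (\<Sum>i<d. defect (a + i) (int b - (int d - 1 - int i)))) = 0"
  unfolding row_sum[OF assms] column_sum[OF assms] telescope[symmetric]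
  by (simp add: right_diff_distrib sum_subtractf)

private lemma defect_outside: "K \<le> a \<or> b < 0 \<Longrightarrow> defect a b = 0"
  by (auto simp: defect_def ext_def)

text \<open>An array that commutes with the shifts is constant along diagonals. A diagonal that starts in
  column 0 below the first row, or ends in the last row before the last column, continues into
  the zeros outside, so it vanishes.\<close>
private lemma toeplitz_like_iff_defect:
  "toeplitz_like K L x \<longleftrightarrow> (\<forall>a b. b < int L \<longrightarrow> defect a b = 0)"
proof
  assume T: "toeplitz_like K L x"
  show "\<forall>a b. b < int L \<longrightarrow> defect a b = 0"
  proof (intro allI impI)
    fix a b assume b: "b < int L"
    show "defect a b = 0"
    proof (cases "K \<le> a \<or> b < 0")
      case True then show ?thesis by (rule defect_outside)
    next
      case False
      then obtain b' where b': "b = int b'" "b' < L" "a < K" using b nonneg_eq_int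
        by (metis linorder_not_le of_nat_less_iff)
      show ?thesis
      proof (cases b')
        case 0
        have "x (Suc a) 0 = 0" if "Suc a < K" using T that b' 0 by (auto simp: toeplitz_like_def)
        then show ?thesis using b' 0 by (simp add: defect_def ext_def)
      next
        case (Suc b'')
        have 1: "x a b'' = (if a + (L - K) \<le> b'' then x 0 (b'' - a) else 0)"
          using T b' Suc by (auto simp: toeplitz_like_def)
        have 2: "x (Suc a) b' = (if Suc a + (L - K) \<le> b' then x 0 (b' - Suc a) else 0)" if "Suc a < K"
          using T b' that by (auto simp: toeplitz_like_def)
        show ?thesis
        proof (cases "Suc a < K")
          case True then show ?thesis using 1 2 b' Suc
            by (auto simp: defect_def ext_def nat_add_distrib)
        next
          case False
          then have "x a b'' = 0" using 1 b' Suc by auto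
          with False show ?thesis using b' Suc by (auto simp: defect_def ext_def)
        qed
      qed
    qed
  qed
next
  assume D: "\<forall>a b. b < int L \<longrightarrow> defect a b = 0"
  have shift: "ext a b = ext (a + k) (b + int k)" if "b + int k < int L" for a b k
    using that
  proof (induction k)
    case (Suc k)
    have "defect (a + k) (b + int (Suc k)) = 0" using D Suc.prems by blast
    then show ?case using Suc by (simp add: defect_def algebra_simps)
  qed simp
  show "toeplitz_like K L x"
    unfolding toeplitz_like_def
  proof (intro allI impI)
    fix a b assume ab: "a < K" "b < L"
    have *: "x a b = ext 0 (int b - int a)"
      using shift[of "int b - int a" a 0] ab by (simp add: ext_def)
    show "x a b = (if a + (L - K) \<le> b then x 0 (b - a) else 0)"
    proof (cases "a \<le> b")
      case False then show ?thesis using * by (simp add: ext_def)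
    next
      case True
      show ?thesis
      proof (cases "a + (L - K) \<le> b")
        case True then show ?thesis using * ab \<open>a \<le> b\<close> by (simp add: ext_def nat_diff_distrib')
      next
        case False
        then have "int b + int (K - a) < int L" using ab \<open>a \<le> b\<close> by linarith
        from shift[OF this, of a] have "ext a (int b) = ext K (int b + int (K - a))" using ab by simp
        then show ?thesis using ab False by (simp add: ext_def)
      qed
    qed
  qed
qed

lemma toeplitz_like_imp_commutes:
  assumes "toeplitz_like K L x" "a < K" "b < L"
  shows "(\<Sum>a'<K. (if a \<le> a' then f (a' - a) else 0) * x a' b) =
      (\<Sum>b'<L. x a b' * (if b' \<le> b then f (b - b') else 0))"
proof -
  have "defect a' (int b - (int d - 1 - int i)) = 0" if "i < d" for a' d i
  proof -
    have "int b - (int d - 1 - int i) < int L" using assms(3) that by linarith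
    then show ?thesis using assms(1) toeplitz_like_iff_defect by blast
  qed
  then show ?thesis unfolding sums_eq_iff[OF assms(2,3)] by simp
qed

text \<open>In the commutator of \<open>f(N)\<close> at \<open>(a, b)\<close> the term \<open>d = 0\<close> cancels, the term \<open>d = 1\<close> is \<open>f 1\<close> times the
  commutator of \<open>N\<close> at \<open>(a, b)\<close>, and the terms \<open>d \<ge> 2\<close> involve that commutator only further down or
  further to the left. Induction from the lower left corner therefore shows that it vanishes; this
  replaces the statement that \<open>N\<close> is a polynomial in \<open>f(N)\<close>.\<close>
lemma commutes_imp_toeplitz_like:
  assumes f1: "f 1 \<noteq> 0"
    and eq: "\<And>a b. a < K \<Longrightarrow> b < L \<Longrightarrow> (\<Sum>a'<K. (if a \<le> a' then f (a' - a) else 0) * x a' b) =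
      (\<Sum>b'<L. x a b' * (if b' \<le> b then f (b - b') else 0))"
  shows "toeplitz_like K L x"
proof -
  have "defect a (int b) = 0" if "b < L" for a b
    using that
  proof (induction "(K - a) + b" arbitrary: a b rule: less_induct)
    case less
    show ?case
    proof (cases "a < K")
      case False then show ?thesis by (simp add: defect_outside)
    next
      case a: True
      have zero: "defect (a + i) (int b - int j) = 0" if "i + j > 0" for i j
      proof (cases "K \<le> a + i \<or> int b - int j < 0")
        case True then show ?thesis by (rule defect_outside)
      next
        case False
        then have "defect (a + i) (int (b - j)) = 0"
          using less.prems that a by (intro less.hyps) auto
        then show ?thesis using False by (simp add: of_nat_diff)
      qed
      have "(\<Sum>i<d. defect (a + i) (int b - (int d - 1 - int i))) = (if d = 1 then defect a (int b) else 0)" for d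
      proof (cases "d = 1")
        case False
        have "defect (a + i) (int b - (int d - 1 - int i)) = 0" if "i < d" for i
        proof -
          have *: "int d - 1 - int i = int (d - 1 - i)" using that by (simp add: of_nat_diff)
          show ?thesis unfolding * by (rule zero) (use that False in auto)
        qed
        then show ?thesis using False by simp
      qed simp
      then have "(\<Sum>d<K + L. f d * (\<Sum>i<d. defect (a + i) (int b - (int d - 1 - int i)))) =
          (\<Sum>d<K + L. if d = 1 then f 1 * defect a (int b) else 0)"
        by (intro sum.cong) auto
      also have "\<dots> = f 1 * defect a (int b)" using a less.prems by simp
      finally show ?thesis using sums_eq_iff[OF a less.prems, of f] eq[OF a less.prems] f1 by simp
    qed
  qed
  then have "defect a b = 0" if "b < int L" for a b
    using that defect_outside[of a b] by (cases "b < 0") (auto simp: not_less elim!: nonneg_eq_int)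
  then show ?thesis using toeplitz_like_iff_defect by blast
qed

text \<open>Upper triangular \<open>f(N)\<close> and lower triangular \<open>g(N)\<^sup>T\<close> with different diagonal entries have no
  nonzero intertwiner: at the entry \<open>(a, b)\<close> the equation reads \<open>(f 0 - g 0) * x a b = 0\<close> up to entries
  with larger indices, so the entries vanish one after another from the lower right corner.\<close>
lemma distinct_diagonals_up:
  assumes ne: "f 0 \<noteq> g 0"
    and eq: "\<And>a b. a < K \<Longrightarrow> b < L \<Longrightarrow> (\<Sum>a'<K. (if a \<le> a' then f (a' - a) else 0) * x a' b) =
      (\<Sum>b'<L. x a b' * (if b \<le> b' then g (b' - b) else 0))"
    and "a < K" "b < L"
  shows "x a b = 0"
  using assms(3,4)
proof (induction "(K - a) + (L - b)" arbitrary: a b rule: less_induct)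
  case less
  have "(\<Sum>a'<K. (if a \<le> a' then f (a' - a) else 0) * x a' b) = (\<Sum>a'<K. if a' = a then f 0 * x a b else 0)"
  proof (rule sum.cong)
    fix a' assume "a' \<in> {..<K}"
    then show "(if a \<le> a' then f (a' - a) else 0) * x a' b = (if a' = a then f 0 * x a b else 0)"
      using less.hyps[of a' b] less.prems by auto
  qed simp
  moreover have "(\<Sum>b'<L. x a b' * (if b \<le> b' then g (b' - b) else 0)) = (\<Sum>b'<L. if b' = b then g 0 * x a b else 0)"
  proof (rule sum.cong)
    fix b' assume "b' \<in> {..<L}"
    then show "x a b' * (if b \<le> b' then g (b' - b) else 0) = (if b' = b then g 0 * x a b else 0)"
      using less.hyps[of a b'] less.prems by auto
  qed simp
  ultimately have "f 0 * x a b = g 0 * x a b" using eq[OF less.prems] less.prems by auto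
  then show ?case using ne by simp
qed

text \<open>The intertwiners in the opposite direction vanish from the upper left corner on.\<close>
lemma distinct_diagonals_down:
  assumes ne: "f 0 \<noteq> g 0"
    and eq: "\<And>a b. a < K \<Longrightarrow> b < L \<Longrightarrow> (\<Sum>a'<K. (if a' \<le> a then g (a - a') else 0) * x a' b) =
      (\<Sum>b'<L. x a b' * (if b' \<le> b then f (b - b') else 0))"
    and "a < K" "b < L"
  shows "x a b = 0"
  using assms(3,4)
proof (induction "a + b" arbitrary: a b rule: less_induct)
  case less
  have "(\<Sum>a'<K. (if a' \<le> a then g (a - a') else 0) * x a' b) = (\<Sum>a'<K. if a' = a then g 0 * x a b else 0)"
  proof (rule sum.cong)
    fix a' assume "a' \<in> {..<K}"
    then show "(if a' \<le> a then g (a - a') else 0) * x a' b = (if a' = a then g 0 * x a b else 0)"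
      using less.hyps[of a' b] less.prems by auto
  qed simp
  moreover have "(\<Sum>b'<L. x a b' * (if b' \<le> b then f (b - b') else 0)) = (\<Sum>b'<L. if b' = b then f 0 * x a b else 0)"
  proof (rule sum.cong)
    fix b' assume "b' \<in> {..<L}"
    then show "x a b' * (if b' \<le> b then f (b - b') else 0) = (if b' = b then f 0 * x a b else 0)"
      using less.hyps[of a b'] less.prems by auto
  qed simp
  ultimately have "g 0 * x a b = f 0 * x a b" using eq[OF less.prems] less.prems by auto
  then show ?case using ne by (metis mult_cancel_right)
qed

end

section \<open>Commutants of direct sums of triangular Toeplitz matrices\<close>

context block_sizes begin

text \<open>The power series \<open>\<Sum>d. f d * N\<^sup>d\<close> in the direct sum \<open>N\<close> of all nilpotent Jordan blocks, in block
  Toeplitz order. Both \<open>f\<close> for the Jordan blocks themselves and \<open>f\<close> for their exponentials occur.\<close>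
definition shift_series :: "(nat \<Rightarrow> complex) \<Rightarrow> complex mat" where
  "shift_series f = Matrix.mat h h (\<lambda>(i, j). case (block_coords i, block_coords j) of ((r, a, p), (s, b, q)) \<Rightarrow>
     if r = s \<and> p = q \<and> a \<le> b then f (b - a) else 0)"

lemma shift_series_carrier [simp]: "shift_series f \<in> carrier_mat h h"
  by (simp add: shift_series_def)

lemma shift_series_index: "valid r a p \<Longrightarrow> valid s b q \<Longrightarrow>
  shift_series f $$ (block_idx r a p, block_idx s b q) = (if r = s \<and> p = q \<and> a \<le> b then f (b - a) else 0)"
  by (simp add: shift_series_def block_idx_less block_coords_block_idx)

text \<open>A row or column of \<open>f(N)\<close> is supported on one chain, so products with \<open>f(N)\<close> split into the scalar
  problems of the previous section, one for each pair of chains.\<close>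
lemma sum_block_idx_column:
  assumes "valid r a p" and "\<And>s b q. valid s b q \<Longrightarrow> F (block_idx s b q) = (if r = s \<and> p = q then G b else 0)"
  shows "(\<Sum>i<h. F i) = (\<Sum>b<\<alpha> r. G b)"
proof -
  have "(\<Sum>i<h. F i) = (\<Sum>s<N. \<Sum>b<\<alpha> s. \<Sum>q<m s. if r = s \<and> p = q then G b else 0)"
    unfolding sum_block_idx by (intro sum.cong refl) (simp add: assms(2) valid_def)
  also have "\<dots> = (\<Sum>s<N. \<Sum>b<\<alpha> s. if r = s then G b else 0)"
    using assms(1) by (intro sum.cong refl) (auto simp: valid_def)
  also have "\<dots> = (\<Sum>s<N. if r = s then \<Sum>b<\<alpha> s. G b else 0)"
    by (intro sum.cong refl) simp
  finally show ?thesis using assms(1) by (simp add: valid_def)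
qed

lemma shift_series_mult_index:
  assumes "M \<in> carrier_mat h h" "valid r a p" "j < h"
  shows "(shift_series f * M) $$ (block_idx r a p, j) =
    (\<Sum>a'<\<alpha> r. (if a \<le> a' then f (a' - a) else 0) * M $$ (block_idx r a' p, j))"
proof -
  have "(shift_series f * M) $$ (block_idx r a p, j) = (\<Sum>k<h. shift_series f $$ (block_idx r a p, k) * M $$ (k, j))"
    using assms by (intro mat_mult_index[of _ h _ _ h]) (auto simp: block_idx_less)
  also have "\<dots> = (\<Sum>a'<\<alpha> r. (if a \<le> a' then f (a' - a) else 0) * M $$ (block_idx r a' p, j))"
    by (rule sum_block_idx_column[OF assms(2)]) (use assms in \<open>auto simp: shift_series_index\<close>)
  finally show ?thesis .
qed

lemma mult_shift_series_index:
  assumes "M \<in> carrier_mat h h" "valid s b q" "i < h"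
  shows "(M * shift_series f) $$ (i, block_idx s b q) =
    (\<Sum>b'<\<alpha> s. M $$ (i, block_idx s b' q) * (if b' \<le> b then f (b - b') else 0))"
proof -
  have "(M * shift_series f) $$ (i, block_idx s b q) = (\<Sum>k<h. M $$ (i, k) * shift_series f $$ (k, block_idx s b q))"
    using assms by (intro mat_mult_index[of _ h _ _ h]) (auto simp: block_idx_less)
  also have "\<dots> = (\<Sum>b'<\<alpha> s. M $$ (i, block_idx s b' q) * (if b' \<le> b then f (b - b') else 0))"
    by (rule sum_block_idx_column[OF assms(2)]) (use assms in \<open>auto simp: shift_series_index\<close>)
  finally show ?thesis .
qed

lemma shift_series_transpose_mult_index:
  assumes "M \<in> carrier_mat h h" "valid r a p" "j < h"
  shows "((shift_series f)\<^sup>T * M) $$ (block_idx r a p, j) =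
    (\<Sum>a'<\<alpha> r. (if a' \<le> a then f (a - a') else 0) * M $$ (block_idx r a' p, j))"
proof -
  have "((shift_series f)\<^sup>T * M) $$ (block_idx r a p, j) = (\<Sum>k<h. (shift_series f)\<^sup>T $$ (block_idx r a p, k) * M $$ (k, j))"
    using assms by (intro mat_mult_index[of _ h _ _ h]) (auto simp: block_idx_less)
  also have "\<dots> = (\<Sum>k<h. shift_series f $$ (k, block_idx r a p) * M $$ (k, j))"
    using assms carrier_matD[OF shift_series_carrier] by (intro sum.cong) (auto simp: block_idx_less)
  also have "\<dots> = (\<Sum>a'<\<alpha> r. (if a' \<le> a then f (a - a') else 0) * M $$ (block_idx r a' p, j))"
    by (rule sum_block_idx_column[OF assms(2)]) (use assms in \<open>auto simp: shift_series_index\<close>)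
  finally show ?thesis .
qed

lemma mult_shift_series_transpose_index:
  assumes "M \<in> carrier_mat h h" "valid s b q" "i < h"
  shows "(M * (shift_series f)\<^sup>T) $$ (i, block_idx s b q) =
    (\<Sum>b'<\<alpha> s. M $$ (i, block_idx s b' q) * (if b \<le> b' then f (b' - b) else 0))"
proof -
  have "(M * (shift_series f)\<^sup>T) $$ (i, block_idx s b q) = (\<Sum>k<h. M $$ (i, k) * (shift_series f)\<^sup>T $$ (k, block_idx s b q))"
    using assms by (intro mat_mult_index[of _ h _ _ h]) (auto simp: block_idx_less)
  also have "\<dots> = (\<Sum>k<h. M $$ (i, k) * shift_series f $$ (block_idx s b q, k))"
    using assms carrier_matD[OF shift_series_carrier] by (intro sum.cong) (auto simp: block_idx_less)
  also have "\<dots> = (\<Sum>b'<\<alpha> s. M $$ (i, block_idx s b' q) * (if b \<le> b' then f (b' - b) else 0))"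
    by (rule sum_block_idx_column[OF assms(2)]) (use assms in \<open>auto simp: shift_series_index\<close>)
  finally show ?thesis .
qed

definition block_toeplitz :: "complex mat \<Rightarrow> bool" where
  "block_toeplitz M \<longleftrightarrow> (\<forall>r<N. \<forall>s<N. \<forall>p<m r. \<forall>q<m s.
     toeplitz_like (\<alpha> r) (\<alpha> s) (\<lambda>a b. M $$ (block_idx r a p, block_idx s b q)))"

lemma block_toeplitz_imp_commutes:
  assumes M: "M \<in> carrier_mat h h" and T: "block_toeplitz M"
  shows "shift_series f * M = M * shift_series f"
proof (rule mat_eqI_block_idx)
  fix r a p s b q assume *: "valid r a p" "valid s b q"
  then show "(shift_series f * M) $$ (block_idx r a p, block_idx s b q) = (M * shift_series f) $$ (block_idx r a p, block_idx s b q)"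
    unfolding shift_series_mult_index[OF M *(1) block_idx_less[OF *(2)]] mult_shift_series_index[OF M *(2) block_idx_less[OF *(1)]]
    using T by (intro toeplitz_like_imp_commutes) (auto simp: block_toeplitz_def valid_def)
qed (use M mult_carrier_mat[OF shift_series_carrier M] mult_carrier_mat[OF M shift_series_carrier] in auto)

lemma commutes_imp_block_toeplitz:
  assumes M: "M \<in> carrier_mat h h" and f: "f 1 \<noteq> 0" and c: "shift_series f * M = M * shift_series f"
  shows "block_toeplitz M"
  unfolding block_toeplitz_def
proof (intro allI impI, rule commutes_imp_toeplitz_like[of f, OF f])
  fix r s p q a b assume "r < N" "s < N" "p < m r" "q < m s" "a < \<alpha> r" "b < \<alpha> s"
  then have *: "valid r a p" "valid s b q" by (auto simp: valid_def)
  show "(\<Sum>a'<\<alpha> r. (if a \<le> a' then f (a' - a) else 0) * M $$ (block_idx r a' p, block_idx s b q)) =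
      (\<Sum>b'<\<alpha> s. M $$ (block_idx r a p, block_idx s b' q) * (if b' \<le> b then f (b - b') else 0))"
    unfolding shift_series_mult_index[OF M *(1) block_idx_less[OF *(2)], symmetric]
      mult_shift_series_index[OF M *(2) block_idx_less[OF *(1)], symmetric] c ..
qed

text \<open>The two diagonal blocks have the single eigenvalues \<open>f 0\<close> and \<open>g 0\<close>; as these differ, a commuting
  matrix is block diagonal.\<close>
lemma commutant_block_diagonal:
  assumes car: "X \<in> carrier_mat h h" "Y \<in> carrier_mat h h" "Z \<in> carrier_mat h h" "W \<in> carrier_mat h h"
    and f0: "f 0 \<noteq> g 0" and f1: "f 1 \<noteq> 0"
    and c: "(shift_series f \<oplus>\<^sub>m (shift_series g)\<^sup>T) * four_block_mat X Y Z W = four_block_mat X Y Z W * (shift_series f \<oplus>\<^sub>m (shift_series g)\<^sup>T)"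
  shows "block_toeplitz X" "Y = 0\<^sub>m h h" "Z = 0\<^sub>m h h"
proof -
  have Lt: "(shift_series g)\<^sup>T \<in> carrier_mat h h" by simp
  note prods = mult_carrier_mat[OF shift_series_carrier] mult_carrier_mat[OF Lt]
    mult_carrier_mat[OF _ shift_series_carrier, of _ h] mult_carrier_mat[OF _ Lt, of _ h]
  have "four_block_mat (shift_series f * X) (shift_series f * Y) ((shift_series g)\<^sup>T * Z) ((shift_series g)\<^sup>T * W) =
      (shift_series f \<oplus>\<^sub>m (shift_series g)\<^sup>T) * four_block_mat X Y Z W"
    unfolding dsum_four_block[OF shift_series_carrier Lt]
    using car Lt prods by (subst mult_four_block_mat[of _ h h _ h _ h _ _ h _ h]) auto
  also note c
  also have "four_block_mat X Y Z W * (shift_series f \<oplus>\<^sub>m (shift_series g)\<^sup>T) = four_block_mat (X * shift_series f) (Y * (shift_series g)\<^sup>T) (Z * shift_series f) (W * (shift_series g)\<^sup>T)"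
    unfolding dsum_four_block[OF shift_series_carrier Lt]
    using car Lt prods by (subst mult_four_block_mat[of _ h h _ h _ h _ _ h _ h]) auto
  finally have eq: "four_block_mat (shift_series f * X) (shift_series f * Y) ((shift_series g)\<^sup>T * Z) ((shift_series g)\<^sup>T * W) =
      four_block_mat (X * shift_series f) (Y * (shift_series g)\<^sup>T) (Z * shift_series f) (W * (shift_series g)\<^sup>T)" .
  have ent: "(shift_series f * X) $$ (i, j) = (X * shift_series f) $$ (i, j)"
    "(shift_series f * Y) $$ (i, j) = (Y * (shift_series g)\<^sup>T) $$ (i, j)"
    "((shift_series g)\<^sup>T * Z) $$ (i, j) = (Z * shift_series f) $$ (i, j)" if "i < h" "j < h" for i j
    using arg_cong[OF eq, of "\<lambda>M. M $$ (i, j)"] arg_cong[OF eq, of "\<lambda>M. M $$ (i, h + j)"]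
      arg_cong[OF eq, of "\<lambda>M. M $$ (h + i, j)"] that car carrier_matD[OF shift_series_carrier]
    by (simp_all del: index_mult_mat(1))
  have "shift_series f * X = X * shift_series f"
    by (rule eq_matI) (use ent car carrier_matD[OF shift_series_carrier] in \<open>auto simp del: index_mult_mat(1)\<close>)
  then show "block_toeplitz X" by (rule commutes_imp_block_toeplitz[of X f, OF car(1) f1])
  show "Y = 0\<^sub>m h h"
  proof (rule mat_eqI_block_idx)
    fix r a p s b q assume *: "valid r a p" "valid s b q"
    have "Y $$ (block_idx r a p, block_idx s b q) = 0"
    proof (rule distinct_diagonals_up[where f = f and g = g and K = "\<alpha> r" and L = "\<alpha> s" and
          x = "\<lambda>a b. Y $$ (block_idx r a p, block_idx s b q)"])
      fix a b assume "a < \<alpha> r" "b < \<alpha> s"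
      then have **: "valid r a p" "valid s b q" using * by (auto simp: valid_def)
      show "(\<Sum>a'<\<alpha> r. (if a \<le> a' then f (a' - a) else 0) * Y $$ (block_idx r a' p, block_idx s b q)) =
          (\<Sum>b'<\<alpha> s. Y $$ (block_idx r a p, block_idx s b' q) * (if b \<le> b' then g (b' - b) else 0))"
        unfolding shift_series_mult_index[OF car(2) **(1) block_idx_less[OF **(2)], symmetric]
          mult_shift_series_transpose_index[OF car(2) **(2) block_idx_less[OF **(1)], symmetric]
        using ent(2) block_idx_less ** by blast
    qed (use f0 * in \<open>auto simp: valid_def\<close>)
    then show "Y $$ (block_idx r a p, block_idx s b q) = 0\<^sub>m h h $$ (block_idx r a p, block_idx s b q)" using * block_idx_less by simp
  qed (use car in auto)
  show "Z = 0\<^sub>m h h"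
  proof (rule mat_eqI_block_idx)
    fix r a p s b q assume *: "valid r a p" "valid s b q"
    have "Z $$ (block_idx r a p, block_idx s b q) = 0"
    proof (rule distinct_diagonals_down[where f = f and g = g and K = "\<alpha> r" and L = "\<alpha> s" and
          x = "\<lambda>a b. Z $$ (block_idx r a p, block_idx s b q)"])
      fix a b assume "a < \<alpha> r" "b < \<alpha> s"
      then have **: "valid r a p" "valid s b q" using * by (auto simp: valid_def)
      show "(\<Sum>a'<\<alpha> r. (if a' \<le> a then g (a - a') else 0) * Z $$ (block_idx r a' p, block_idx s b q)) =
          (\<Sum>b'<\<alpha> s. Z $$ (block_idx r a p, block_idx s b' q) * (if b' \<le> b then f (b - b') else 0))"
        unfolding shift_series_transpose_mult_index[OF car(3) **(1) block_idx_less[OF **(2)], symmetric]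
          mult_shift_series_index[OF car(3) **(2) block_idx_less[OF **(1)], symmetric]
        using ent(3) block_idx_less ** by blast
    qed (use f0 * in \<open>auto simp: valid_def\<close>)
    then show "Z $$ (block_idx r a p, block_idx s b q) = 0\<^sub>m h h $$ (block_idx r a p, block_idx s b q)" using * block_idx_less by simp
  qed (use car in auto)
qed

end

section \<open>The group of block Toeplitz matrices is a commutant\<close>

context block_sizes begin

lemma block_padded_toeplitz_index:
  assumes "valid r a p" "valid s b q"
  shows "block_mat (map (\<lambda>r. \<alpha> r * m r) [0..<N]) (map (\<lambda>r. \<alpha> r * m r) [0..<N])
      (\<lambda>r s. padded_toeplitz (\<alpha> r) (\<alpha> s) (m r) (m s) (A r s)) $$ (block_idx r a p, block_idx s b q) =
    (if a + (\<alpha> s - \<alpha> r) \<le> b then A r s (b - a - (\<alpha> s - \<alpha> r)) $$ (p, q) else 0)"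
  unfolding block_idx_def using assms
  by (subst block_mat_offset) (auto simp: valid_def prod_index_less padded_toeplitz_index)

lemma TT_imp_block_toeplitz:
  assumes "X \<in> TT N \<alpha> m" shows "X \<in> carrier (GL h)" "block_toeplitz X"
proof -
  show "X \<in> carrier (GL h)" using assms by (simp add: TT_def)
  obtain A where X: "X = block_mat (map (\<lambda>r. \<alpha> r * m r) [0..<N]) (map (\<lambda>r. \<alpha> r * m r) [0..<N])
             (\<lambda>r s. padded_toeplitz (\<alpha> r) (\<alpha> s) (m r) (m s) (A r s))"
    using assms by (auto simp: TT_def)
  show "block_toeplitz X"
    unfolding block_toeplitz_def toeplitz_like_def
  proof (intro allI impI)
    fix r s p q a b assume "r < N" "s < N" "p < m r" "q < m s" "a < \<alpha> r" "b < \<alpha> s"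
    then have "valid r a p" "valid s b q" "valid r 0 p" "valid s (b - a) q" by (auto simp: valid_def)
    then show "X $$ (block_idx r a p, block_idx s b q) =
        (if a + (\<alpha> s - \<alpha> r) \<le> b then X $$ (block_idx r 0 p, block_idx s (b - a) q) else 0)"
      unfolding X by (auto simp: block_padded_toeplitz_index)
  qed
qed

lemma block_toeplitz_iff_commutes:
  "M \<in> carrier_mat h h \<Longrightarrow>
     block_toeplitz M \<longleftrightarrow> shift_series (\<lambda>d. if d = 1 then 1 else 0) * M = M * shift_series (\<lambda>d. if d = 1 then 1 else 0)"
  using block_toeplitz_imp_commutes[of M "\<lambda>d. if d = 1 then 1 else 0"]
    commutes_imp_block_toeplitz[of M "\<lambda>d. if d = 1 then 1 else 0"] by auto

text \<open>The inverse of a matrix commutes with everything that the matrix commutes with.\<close>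
lemma block_toeplitz_inv:
  assumes "X \<in> carrier (GL h)" "block_toeplitz X" shows "block_toeplitz (GL_inv h X)"
  using GL_commutes_inv[OF assms(1) shift_series_carrier] assms(2)
  unfolding block_toeplitz_iff_commutes[OF GL_carrier[OF assms(1)]] block_toeplitz_iff_commutes[OF GL_inv(2)[OF assms(1)]]
  by simp

lemma block_toeplitz_mult:
  assumes X: "X \<in> carrier_mat h h" "block_toeplitz X" and Y: "Y \<in> carrier_mat h h" "block_toeplitz Y"
  shows "block_toeplitz (X * Y)"
proof -
  let ?J = "shift_series (\<lambda>d. if d = 1 then 1 else 0)"
  have "?J * (X * Y) = ?J * X * Y" using X Y by (simp add: assoc_mult_mat[of _ h h _ h _ h])
  also have "\<dots> = X * (?J * Y)" using X Y block_toeplitz_imp_commutes[OF X]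
    by (simp add: assoc_mult_mat[of _ h h _ h _ h])
  also have "\<dots> = X * Y * ?J" using X Y block_toeplitz_imp_commutes[OF Y]
    by (simp add: assoc_mult_mat[of _ h h _ h _ h])
  finally show ?thesis using block_toeplitz_iff_commutes[OF mult_carrier_mat[OF X(1) Y(1)]] by simp
qed

lemma block_toeplitz_one: "block_toeplitz (1\<^sub>m h)"
  unfolding block_toeplitz_iff_commutes[OF one_carrier_mat]
    left_mult_one_mat[OF shift_series_carrier] right_mult_one_mat[OF shift_series_carrier] ..

end

locale decreasing_block_sizes = block_sizes +
  assumes \<alpha>_pos: "r < N \<Longrightarrow> 0 < \<alpha> r"
    and \<alpha>_decr: "r < s \<Longrightarrow> s < N \<Longrightarrow> \<alpha> s < \<alpha> r"
begin

lemma \<alpha>_eq_iff: "r < N \<Longrightarrow> s < N \<Longrightarrow> \<alpha> r = \<alpha> s \<longleftrightarrow> r = s"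
  using \<alpha>_decr[of r s] \<alpha>_decr[of s r] by (cases r s rule: linorder_cases) auto

text \<open>A product term that passes through a size \<open>\<alpha> s \<noteq> \<alpha> r\<close> vanishes. If \<open>\<alpha> s < \<alpha> r\<close>, the zero padding makes the
  first column of blocks of the second factor zero; if \<open>\<alpha> s > \<alpha> r\<close>, it makes that of the first factor
  zero, and the second factor has nothing below its first row there. So the leading diagonal blocks
  multiply among themselves; this is where distinctness of the sizes enters.\<close>
lemma leading_block_mult:
  assumes X: "X \<in> carrier_mat h h" "block_toeplitz X" and Y: "Y \<in> carrier_mat h h" "block_toeplitz Y"
    and r: "valid r 0 p" "valid r 0 q"
  shows "(X * Y) $$ (block_idx r 0 p, block_idx r 0 q) = (\<Sum>t<m r. X $$ (block_idx r 0 p, block_idx r 0 t) * Y $$ (block_idx r 0 t, block_idx r 0 q))"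
proof -
  have z: "X $$ (block_idx r 0 p, block_idx s b t) * Y $$ (block_idx s b t, block_idx r 0 q) =
      (if s = r \<and> b = 0 then X $$ (block_idx r 0 p, block_idx r 0 t) * Y $$ (block_idx r 0 t, block_idx r 0 q) else 0)"
    if "s < N" "b < \<alpha> s" "t < m s" for s b t
  proof -
    have "toeplitz_like (\<alpha> r) (\<alpha> s) (\<lambda>a b. X $$ (block_idx r a p, block_idx s b t))"
      "toeplitz_like (\<alpha> s) (\<alpha> r) (\<lambda>a b. Y $$ (block_idx s a t, block_idx r b q))"
      using X Y r that by (auto simp: block_toeplitz_def valid_def)
    note T = this[unfolded toeplitz_like_def, rule_format]
    have "X $$ (block_idx r 0 p, block_idx s b t) = 0 \<or> \<alpha> s - \<alpha> r \<le> b"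
    proof -
      have "X $$ (block_idx r 0 p, block_idx s b t) = (if 0 + (\<alpha> s - \<alpha> r) \<le> b then X $$ (block_idx r 0 p, block_idx s (b - 0) t) else 0)"
        by (rule T(1)) (use r that in \<open>auto simp: valid_def\<close>)
      then show ?thesis using if_not_P by (metis add_0)
    qed
    moreover have "Y $$ (block_idx s b t, block_idx r 0 q) = 0 \<or> b + (\<alpha> r - \<alpha> s) \<le> 0"
    proof -
      have "Y $$ (block_idx s b t, block_idx r 0 q) = (if b + (\<alpha> r - \<alpha> s) \<le> 0 then Y $$ (block_idx s 0 t, block_idx r (0 - b) q) else 0)"
        by (rule T(2)) (use r that in \<open>auto simp: valid_def\<close>)
      then show ?thesis using if_not_P by metis
    qed
    ultimately show ?thesis using \<alpha>_eq_iff[OF that(1), of r] r by (auto simp: valid_def)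
  qed
  have "(X * Y) $$ (block_idx r 0 p, block_idx r 0 q) =
      (\<Sum>k<h. X $$ (block_idx r 0 p, k) * Y $$ (k, block_idx r 0 q))"
    using X Y r block_idx_less by (intro mat_mult_index[of _ h _ _ h]) auto
  also have "\<dots> = (\<Sum>s<N. \<Sum>b<\<alpha> s. \<Sum>t<m s. if s = r \<and> b = 0
      then X $$ (block_idx r 0 p, block_idx r 0 t) * Y $$ (block_idx r 0 t, block_idx r 0 q) else 0)"
    unfolding sum_block_idx using z by (intro sum.cong refl) auto
  also have "\<dots> = (\<Sum>s<N. \<Sum>b<\<alpha> s. if b = 0 then (if s = r
      then \<Sum>t<m s. X $$ (block_idx r 0 p, block_idx r 0 t) * Y $$ (block_idx r 0 t, block_idx r 0 q) else 0) else 0)"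
    by (intro sum.cong refl) auto
  also have "\<dots> = (\<Sum>s<N. if s = r
      then \<Sum>t<m s. X $$ (block_idx r 0 p, block_idx r 0 t) * Y $$ (block_idx r 0 t, block_idx r 0 q) else 0)"
    using \<alpha>_pos by (intro sum.cong refl) simp
  finally show ?thesis using r by (simp add: valid_def)
qed

text \<open>Nonsingularity of the leading coefficients is automatic: the leading blocks of a matrix and of
  its inverse are inverse to each other, since the inverse is again block Toeplitz.\<close>
lemma TT_iff: "X \<in> TT N \<alpha> m \<longleftrightarrow> X \<in> carrier (GL h) \<and> block_toeplitz X"
proof
  assume "X \<in> TT N \<alpha> m" then show "X \<in> carrier (GL h) \<and> block_toeplitz X" using TT_imp_block_toeplitz by blast
next
  assume "X \<in> carrier (GL h) \<and> block_toeplitz X"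
  then have G: "X \<in> carrier (GL h)" and T: "block_toeplitz X" by auto
  note Xc = GL_carrier[OF G] and Y = GL_inv[OF G]
  define A where "A r s j = Matrix.mat (m r) (m s) (\<lambda>(p, q). X $$ (block_idx r 0 p, block_idx s (j + (\<alpha> s - \<alpha> r)) q))"
    for r s j :: nat
  have "A r r 0 \<in> carrier (GL (m r))" if "r < N" for r
  proof (rule GL_I(1))
    let ?B = "Matrix.mat (m r) (m r) (\<lambda>(p, q). GL_inv h X $$ (block_idx r 0 p, block_idx r 0 q))"
    show c: "A r r 0 \<in> carrier_mat (m r) (m r)" "?B \<in> carrier_mat (m r) (m r)" by (auto simp: A_def)
    show "A r r 0 * ?B = 1\<^sub>m (m r)"
    proof (rule eq_matI)
      fix p q assume "p < dim_row (1\<^sub>m (m r) :: complex mat)" "q < dim_col (1\<^sub>m (m r) :: complex mat)"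
      then have pq: "p < m r" "q < m r" by auto
      then have ps: "valid r 0 p" "valid r 0 q" using that \<alpha>_pos by (auto simp: valid_def)
      have "(A r r 0 * ?B) $$ (p, q) = (\<Sum>t<m r. A r r 0 $$ (p, t) * ?B $$ (t, q))"
        using c pq by (intro mat_mult_index[of _ "m r" _ _ "m r"]) auto
      also have "\<dots> = (X * GL_inv h X) $$ (block_idx r 0 p, block_idx r 0 q)"
        unfolding leading_block_mult[OF Xc T Y(2) block_toeplitz_inv[OF G T] ps]
        using pq by (intro sum.cong refl) (auto simp: A_def)
      also have "\<dots> = 1\<^sub>m (m r) $$ (p, q)"
        using Y(3) ps pq by (simp add: block_idx_less block_idx_eq_iff del: index_mult_mat(1))
      finally show "(A r r 0 * ?B) $$ (p, q) = 1\<^sub>m (m r) $$ (p, q)" .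
    qed (auto simp: A_def)
  qed
  moreover have "X = block_mat (map (\<lambda>r. \<alpha> r * m r) [0..<N]) (map (\<lambda>r. \<alpha> r * m r) [0..<N])
             (\<lambda>r s. padded_toeplitz (\<alpha> r) (\<alpha> s) (m r) (m s) (A r s))" (is "X = ?X")
  proof (rule mat_eqI_block_idx[OF Xc])
    show "?X \<in> carrier_mat h h" unfolding h_offset by (rule block_mat_carrier)
    fix r a p s b q assume *: "valid r a p" "valid s b q"
    then have "toeplitz_like (\<alpha> r) (\<alpha> s) (\<lambda>a b. X $$ (block_idx r a p, block_idx s b q))"
      using T by (auto simp: block_toeplitz_def valid_def)
    then have "X $$ (block_idx r a p, block_idx s b q) =
        (if a + (\<alpha> s - \<alpha> r) \<le> b then X $$ (block_idx r 0 p, block_idx s (b - a) q) else 0)"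
      using * unfolding toeplitz_like_def valid_def by blast
    then show "X $$ (block_idx r a p, block_idx s b q) = ?X $$ (block_idx r a p, block_idx s b q)"
      unfolding block_padded_toeplitz_index[OF *] using * by (auto simp: A_def valid_def)
  qed
  moreover have "A r s j \<in> carrier_mat (m r) (m s)" for r s j by (simp add: A_def)
  ultimately show "X \<in> TT N \<alpha> m" unfolding TT_def
    by (intro CollectI conjI[OF G] exI[of _ A]) simp
qed

section \<open>The subgroup of direct sums\<close>

lemma XX_I: "X \<in> TT N \<alpha> m \<Longrightarrow> X \<oplus>\<^sub>m (GL_inv h X)\<^sup>T \<in> XX N \<alpha> m"
  unfolding XX_def by blast

lemma XX_subgroup: "subgroup (XX N \<alpha> m) (GL (2 * h))"
proof (rule group.subgroupI[OF GL_group])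
  have c: "GL_inv h X \<in> carrier_mat h h" "X \<in> carrier_mat h h" "(GL_inv h X)\<^sup>T \<in> carrier (GL h)"
    if "X \<in> TT N \<alpha> m" for X
  proof -
    have X: "X \<in> carrier (GL h)" using that TT_iff by blast
    show "GL_inv h X \<in> carrier_mat h h" "X \<in> carrier_mat h h" "(GL_inv h X)\<^sup>T \<in> carrier (GL h)"
      using GL_inv[OF X] GL_carrier[OF X] GL_transpose(1)[OF GL_inv(1)[OF X]] by auto
  qed
  show "XX N \<alpha> m \<subseteq> carrier (GL (2 * h))"
  proof
    fix Q assume "Q \<in> XX N \<alpha> m"
    then obtain X where X: "X \<in> TT N \<alpha> m" "Q = X \<oplus>\<^sub>m (GL_inv h X)\<^sup>T" by (auto simp: XX_def)
    have "X \<in> carrier (GL h)" using X TT_iff by blast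
    from dsum_GL(1)[OF this c(3)[OF X(1)]] show "Q \<in> carrier (GL (2 * h))" by (simp add: X(2) mult_2)
  qed
  have "1\<^sub>m h \<in> TT N \<alpha> m" using TT_iff block_toeplitz_one GL_I(1)[of "1\<^sub>m h" h "1\<^sub>m h"] by simp
  then show "XX N \<alpha> m \<noteq> {}" unfolding XX_def by blast
  fix Q assume "Q \<in> XX N \<alpha> m"
  then obtain X where X: "X \<in> TT N \<alpha> m" "Q = X \<oplus>\<^sub>m (GL_inv h X)\<^sup>T" by (auto simp: XX_def)
  have XG: "X \<in> carrier (GL h)" and XT: "block_toeplitz X" using X TT_iff by blast+
  have "GL_inv (2 * h) Q = GL_inv h X \<oplus>\<^sub>m (GL_inv h (GL_inv h X))\<^sup>T"
    using X(2) dsum_GL(2)[OF XG c(3)[OF X(1)]] GL_transpose(2)[OF GL_inv(1)[OF XG]] by (simp add: mult_2)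
  moreover have "GL_inv h X \<in> TT N \<alpha> m" using TT_iff block_toeplitz_inv[OF XG XT] GL_inv(1)[OF XG] by blast
  ultimately show "GL_inv (2 * h) Q \<in> XX N \<alpha> m" by (simp add: XX_I)
  fix R assume "R \<in> XX N \<alpha> m"
  then obtain Y where Y: "Y \<in> TT N \<alpha> m" "R = Y \<oplus>\<^sub>m (GL_inv h Y)\<^sup>T" by (auto simp: XX_def)
  have YG: "Y \<in> carrier (GL h)" and YT: "block_toeplitz Y" using Y TT_iff by blast+
  have "(GL_inv h X)\<^sup>T * (GL_inv h Y)\<^sup>T = (GL_inv h (X * Y))\<^sup>T"
    using GL_mult(2)[OF XG YG] transpose_mult[OF c(1)[OF Y(1)] c(1)[OF X(1)]] by simp
  then have "Q * R = (X * Y) \<oplus>\<^sub>m (GL_inv h (X * Y))\<^sup>T"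
    unfolding X(2) Y(2) using c[OF X(1)] c[OF Y(1)] by (subst dsum_mult[of _ h _ h]) auto
  moreover have "X * Y \<in> TT N \<alpha> m"
    using TT_iff block_toeplitz_mult[OF GL_carrier[OF XG] XT GL_carrier[OF YG] YT] GL_mult(1)[OF XG YG] by blast
  ultimately have "Q * R \<in> XX N \<alpha> m" by (simp add: XX_I)
  then show "Q \<otimes>\<^bsub>GL (2 * h)\<^esub> R \<in> XX N \<alpha> m" by (simp only: GL_simps)
qed

end

context block_sizes begin

text \<open>Reversal of every Jordan chain. It turns \<open>N\<^sup>T\<close> into \<open>N\<close>, so it conjugates inverse transposes of block
  Toeplitz matrices to block Toeplitz matrices.\<close>
definition flip :: "nat \<Rightarrow> nat" where
  "flip i = (let (r, a, p) = block_coords i in block_idx r (\<alpha> r - 1 - a) p)"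

lemma flip_block_idx: "valid r a p \<Longrightarrow> flip (block_idx r a p) = block_idx r (\<alpha> r - 1 - a) p"
  by (simp add: flip_def block_coords_block_idx)

lemma valid_flip: "valid r a p \<Longrightarrow> valid r (\<alpha> r - 1 - a) p"
  by (auto simp: valid_def)

lemma flip_bij: "bij_betw flip {..<h} {..<h}"
proof (rule bij_betw_byWitness[of _ flip])
  have "flip i < h \<and> flip (flip i) = i" if "i < h" for i
    using that
  proof (rule block_idx_ex)
    fix r a p assume *: "valid r a p" "i = block_idx r a p"
    then have "flip i = block_idx r (\<alpha> r - 1 - a) p" "flip (flip i) = block_idx r (\<alpha> r - 1 - (\<alpha> r - 1 - a)) p"
      using flip_block_idx[OF *(1)] flip_block_idx[OF valid_flip[OF *(1)]] *(2) by simp_all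
    moreover have "\<alpha> r - 1 - (\<alpha> r - 1 - a) = a" using * by (auto simp: valid_def)
    ultimately show ?thesis using * block_idx_less[OF valid_flip[OF *(1)]] by simp
  qed
  then show "\<forall>a\<in>{..<h}. flip (flip a) = a" "\<forall>a\<in>{..<h}. flip (flip a) = a"
    "flip ` {..<h} \<subseteq> {..<h}" "flip ` {..<h} \<subseteq> {..<h}" by auto
qed

lemma reindex_flip_shift_series: "reindex h flip ((shift_series f)\<^sup>T) = shift_series f"
proof (rule mat_eqI_block_idx)
  fix r a p s b q assume *: "valid r a p" "valid s b q"
  have "reindex h flip ((shift_series f)\<^sup>T) $$ (block_idx r a p, block_idx s b q) = shift_series f $$ (block_idx s (\<alpha> s - 1 - b) q, block_idx r (\<alpha> r - 1 - a) p)"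
    using * block_idx_less valid_flip carrier_matD[OF shift_series_carrier] by (simp add: reindex_index flip_block_idx)
  also have "\<dots> = shift_series f $$ (block_idx r a p, block_idx s b q)"
    unfolding shift_series_index[OF valid_flip[OF *(2)] valid_flip[OF *(1)]] shift_series_index[OF *]
    using * by (auto simp: valid_def intro!: arg_cong[of _ _ f])
  finally show "reindex h flip ((shift_series f)\<^sup>T) $$ (block_idx r a p, block_idx s b q) = shift_series f $$ (block_idx r a p, block_idx s b q)" .
qed auto

lemma block_toeplitz_reindex_flip:
  assumes "X \<in> carrier_mat h h" "block_toeplitz X" shows "block_toeplitz (reindex h flip (X\<^sup>T))"
proof -
  let ?J = "shift_series (\<lambda>d. if d = 1 then 1 else 0)"
  have "?J * reindex h flip (X\<^sup>T) = reindex h flip (?J\<^sup>T * X\<^sup>T)"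
    using assms by (simp add: reindex_mult[OF flip_bij] reindex_flip_shift_series)
  also have "?J\<^sup>T * X\<^sup>T = X\<^sup>T * ?J\<^sup>T"
    using block_toeplitz_imp_commutes[OF assms, of "\<lambda>d. if d = 1 then 1 else 0"] assms
      transpose_mult[OF assms(1) shift_series_carrier] transpose_mult[OF shift_series_carrier assms(1)] by metis
  also have "reindex h flip (X\<^sup>T * ?J\<^sup>T) = reindex h flip (X\<^sup>T) * ?J"
    using assms by (simp add: reindex_mult[OF flip_bij] reindex_flip_shift_series)
  finally show ?thesis by (simp add: block_toeplitz_iff_commutes)
qed

end

context decreasing_block_sizes begin

lemma XX_conj_subset_TT_dsum:
  "\<exists>F \<in> carrier (GL h). conj_image (2 * h) (1\<^sub>m h \<oplus>\<^sub>m F) (XX N \<alpha> m) \<subseteq> TT_dsum N \<alpha> m"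
proof -
  obtain F where F: "F \<in> carrier (GL h)"
    "\<And>M. M \<in> carrier_mat h h \<Longrightarrow> GL_inv h F * M * F = reindex h flip M"
    by (rule perm_matrix[OF flip_bij]) blast
  have one: "1\<^sub>m h \<in> carrier (GL h)" "GL_inv h (1\<^sub>m h) = 1\<^sub>m h"
    using GL_I[of "1\<^sub>m h" h "1\<^sub>m h"] by auto
  have "GL_inv (2 * h) (1\<^sub>m h \<oplus>\<^sub>m F) * Q * (1\<^sub>m h \<oplus>\<^sub>m F) \<in> TT_dsum N \<alpha> m" if Q: "Q \<in> XX N \<alpha> m" for Q
  proof -
    obtain X where X: "X \<in> TT N \<alpha> m" "Q = X \<oplus>\<^sub>m (GL_inv h X)\<^sup>T" using Q by (auto simp: XX_def)
    have XG: "X \<in> carrier (GL h)" "block_toeplitz X" using X TT_iff by blast+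
    note c = GL_carrier[OF XG(1)] GL_inv(2)[OF XG(1)] GL_carrier[OF F(1)] GL_inv(2)[OF F(1)]
    have ct: "(GL_inv h X)\<^sup>T \<in> carrier_mat h h" using c by simp
    have "GL_inv (2 * h) (1\<^sub>m h \<oplus>\<^sub>m F) * Q * (1\<^sub>m h \<oplus>\<^sub>m F) =
        X \<oplus>\<^sub>m (GL_inv h F * (GL_inv h X)\<^sup>T * F)"
      unfolding X(2) using dsum_GL(2)[OF one(1) F(1)] c ct one
      by (simp add: mult_2 dsum_mult[of _ h _ h])
    also have "\<dots> = X \<oplus>\<^sub>m reindex h flip ((GL_inv h X)\<^sup>T)" using F(2)[OF ct] by simp
    finally have "GL_inv (2 * h) (1\<^sub>m h \<oplus>\<^sub>m F) * Q * (1\<^sub>m h \<oplus>\<^sub>m F) =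
      X \<oplus>\<^sub>m reindex h flip ((GL_inv h X)\<^sup>T)" .
    moreover have "reindex h flip ((GL_inv h X)\<^sup>T) \<in> TT N \<alpha> m"
      unfolding TT_iff using block_toeplitz_reindex_flip[OF c(2) block_toeplitz_inv[OF XG]]
        reindex_GL[OF flip_bij ct] GL_transpose(1)[OF GL_inv(1)[OF XG(1)]] by blast
    ultimately show ?thesis using X(1) by (auto simp: TT_dsum_def)
  qed
  then show ?thesis using F(1) unfolding conj_image_def by blast
qed

end

section \<open>The normal forms in the common order of basis vectors\<close>

text \<open>The diagonals of the powers of a Jordan block are binomial terms; the exponential series turns
  them into the derivatives of the exponential function divided by factorials.\<close>
lemma binomial_exp_sums:
  fixes z :: complex
  shows "(\<lambda>k. of_nat (k choose d) * z ^ (k - d) / fact k) sums (exp z / fact d)"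
proof -
  have "(\<lambda>i. of_nat (i + d choose d) * z ^ (i + d - d) / fact (i + d)) = (\<lambda>i. (z ^ i /\<^sub>R fact i) / fact d)"
    by (rule ext) (simp add: binomial_fact scaleR_conv_of_real field_simps)
  then have "(\<lambda>i. of_nat (i + d choose d) * z ^ (i + d - d) / fact (i + d)) sums (exp z / fact d)"
    using sums_divide[OF exp_converges[of z], of "fact d"] by simp
  then show ?thesis
    by (subst (asm) sums_zero_iff_shift[of d "\<lambda>k. of_nat (k choose d) * z ^ (k - d) / fact k"]) auto
qed

lemma jordan_block_pow_exp_sums:
  assumes "a < n" "b < n"
  shows "(\<lambda>k. ((jordan_block n z) ^\<^sub>m k) $$ (a, b) / fact k) sums
    (if a \<le> b then exp z / fact (b - a) else 0 :: complex)"
proof (cases "a \<le> b")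
  case True
  have "(\<lambda>k. ((jordan_block n z) ^\<^sub>m k) $$ (a, b) / fact k) =
      (\<lambda>k. of_nat (k choose (b - a)) * z ^ (k - (b - a)) / fact k)"
    using True assms by (intro ext) (simp add: jordan_block_pow)
  then show ?thesis using True binomial_exp_sums[of "b - a" z] by simp
qed (use assms in \<open>simp add: jordan_block_pow\<close>)

lemma pow_mat_commute:
  assumes "A \<in> carrier_mat n n" shows "A * A ^\<^sub>m k = A ^\<^sub>m k * (A :: complex mat)"
proof (induction k)
  case (Suc k)
  have "A * A ^\<^sub>m Suc k = (A * A ^\<^sub>m k) * A"
    using assms by (simp add: assoc_mult_mat[of _ n n _ n _ n])
  then show ?case using Suc by simp
qed (use assms in simp)

lemma neg_transpose_pow:
  assumes A: "(A :: complex mat) \<in> carrier_mat n n"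
  shows "(- A\<^sup>T) ^\<^sub>m k = (-1) ^ k \<cdot>\<^sub>m (A ^\<^sub>m k)\<^sup>T"
proof (induction k)
  case 0 then show ?case using A by (auto intro!: eq_matI)
next
  case (Suc k)
  have P: "A ^\<^sub>m k \<in> carrier_mat n n" using A by simp
  have "(- A\<^sup>T) ^\<^sub>m Suc k = ((-1) ^ k \<cdot>\<^sub>m (A ^\<^sub>m k)\<^sup>T) * (- A\<^sup>T)" using Suc by simp
  also have "\<dots> = (-1) ^ Suc k \<cdot>\<^sub>m ((A ^\<^sub>m k)\<^sup>T * A\<^sup>T)"
    using A P by (intro eq_matI) (auto simp: scalar_prod_def sum_negf sum_distrib_left algebra_simps)
  also have "(A ^\<^sub>m k)\<^sup>T * A\<^sup>T = (A ^\<^sub>m Suc k)\<^sup>T"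
    using transpose_mult[OF A P] pow_mat_commute[OF A] by simp
  finally show ?case .
qed

lemma neg_transpose_jordan_block_pow_exp_sums:
  assumes "a < n" "b < n"
  shows "(\<lambda>k. ((- (jordan_block n z)\<^sup>T) ^\<^sub>m k) $$ (a, b) / fact k) sums
    (if b \<le> a then (-1) ^ (a - b) * exp (- z) / fact (a - b) else 0 :: complex)"
proof -
  have car: "jordan_block n z \<in> carrier_mat n n" by simp
  have eq: "((- (jordan_block n z)\<^sup>T) ^\<^sub>m k) $$ (a, b) = (-1) ^ k * (jordan_block n z ^\<^sub>m k) $$ (b, a)" for k
    unfolding neg_transpose_pow[OF car] using assms by simp
  show ?thesis
  proof (cases "b \<le> a")
    case True
    have s: "(-1) ^ k * (of_nat (k choose d) * z ^ (k - d)) = (-1) ^ d * (of_nat (k choose d) * (- z) ^ (k - d))"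
      for k d
    proof (cases "d \<le> k")
      case True
      then have "(-1 :: complex) ^ k = (-1) ^ d * (-1) ^ (k - d)" by (simp flip: power_add)
      moreover have "(- z) ^ (k - d) = (-1) ^ (k - d) * z ^ (k - d)" by (rule power_minus)
      ultimately show ?thesis by (simp add: algebra_simps)
    qed simp
    have "(\<lambda>k. ((- (jordan_block n z)\<^sup>T) ^\<^sub>m k) $$ (a, b) / fact k) =
        (\<lambda>k. (-1) ^ (a - b) * (of_nat (k choose (a - b)) * (- z) ^ (k - (a - b)) / fact k))"
      unfolding eq using True assms s[of _ "a - b"] by (intro ext) (simp add: jordan_block_pow)
    then show ?thesis using True sums_mult[OF binomial_exp_sums[of "a - b" "- z"], of "(-1) ^ (a - b)"]
      by simp
  qed (use assms in \<open>simp add: eq jordan_block_pow\<close>)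
qed

context block_sizes begin

lemma reindex_reorder_shift_series:
  assumes "\<And>r a p s b q \<epsilon> \<delta>. valid r a p \<Longrightarrow> valid s b q \<Longrightarrow> \<epsilon> < 2 \<Longrightarrow> \<delta> < 2 \<Longrightarrow>
      M $$ (chain_idx r p \<epsilon> a, chain_idx s q \<delta> b) = (if r = s \<and> p = q \<and> \<epsilon> = \<delta> then
         if \<epsilon> = 0 then if a \<le> b then f (b - a) else 0 else if b \<le> a then g (a - b) else 0 else 0)"
  shows "reindex (2 * h) reorder M = shift_series f \<oplus>\<^sub>m (shift_series g)\<^sup>T"
proof -
  have Lt: "(shift_series g)\<^sup>T \<in> carrier_mat h h" by simp
  show ?thesis unfolding dsum_four_block[OF shift_series_carrier Lt]
    by (rule reindex_reorder_four_block)
      (use assms block_idx_less carrier_matD[OF shift_series_carrier] in \<open>auto simp: shift_series_index\<close>)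
qed

lemma AA_pow:
  "AA N \<alpha> m z ^\<^sub>m k = diag_block_mat (map (\<lambda>r. diag_block_mat (replicate (m r)
     (jordan_block (\<alpha> r) z ^\<^sub>m k \<oplus>\<^sub>m (- (jordan_block (\<alpha> r) z)\<^sup>T) ^\<^sub>m k))) [0..<N])"
proof -
  have c: "jordan_block (\<alpha> r) z \<in> carrier_mat (\<alpha> r) (\<alpha> r)"
    "- (jordan_block (\<alpha> r) z)\<^sup>T \<in> carrier_mat (\<alpha> r) (\<alpha> r)" for r by auto
  have "(jordan_block (\<alpha> r) z \<oplus>\<^sub>m - (jordan_block (\<alpha> r) z)\<^sup>T) ^\<^sub>m k =
      jordan_block (\<alpha> r) z ^\<^sub>m k \<oplus>\<^sub>m (- (jordan_block (\<alpha> r) z)\<^sup>T) ^\<^sub>m k" for r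
    unfolding dsum_def by (subst diag_block_pow_mat) auto
  moreover have sq: "square_mat (jordan_block (\<alpha> r) z \<oplus>\<^sub>m - (jordan_block (\<alpha> r) z)\<^sup>T)" for r
    using dsum_carrier[OF c(1)[of r] c(2)[of r]] by simp
  moreover have "square_mat (diag_block_mat (replicate (m r) (jordan_block (\<alpha> r) z \<oplus>\<^sub>m - (jordan_block (\<alpha> r) z)\<^sup>T)))" for r
    using sq[of r] by (intro diag_block_mat_square) auto
  ultimately show ?thesis unfolding AA_def
    by (simp add: diag_block_pow_mat o_def del: square_mat.simps)
qed

lemma AA_pow_index:
  assumes "valid r a p" "valid s b q" "\<epsilon> < 2" "\<delta> < 2"
  shows "(AA N \<alpha> m z ^\<^sub>m k) $$ (chain_idx r p \<epsilon> a, chain_idx s q \<delta> b) = (if r = s \<and> p = q \<and> \<epsilon> = \<delta> then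
      if \<epsilon> = 0 then (jordan_block (\<alpha> r) z ^\<^sub>m k) $$ (a, b)
      else ((- (jordan_block (\<alpha> r) z)\<^sup>T) ^\<^sub>m k) $$ (a, b) else 0)"
proof -
  have c: "jordan_block (\<alpha> r) z ^\<^sub>m k \<in> carrier_mat (\<alpha> r) (\<alpha> r)"
    "(- (jordan_block (\<alpha> r) z)\<^sup>T) ^\<^sub>m k \<in> carrier_mat (\<alpha> r) (\<alpha> r)" for r
    by (intro pow_carrier_mat; auto)+
  have d: "jordan_block (\<alpha> r) z ^\<^sub>m k \<oplus>\<^sub>m (- (jordan_block (\<alpha> r) z)\<^sup>T) ^\<^sub>m k \<in> carrier_mat (2 * \<alpha> r) (2 * \<alpha> r)" for r
    using dsum_carrier[OF c(1)[of r] c(2)[of r]] by (simp add: mult_2)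
  have "\<epsilon> = 0 \<or> \<epsilon> = 1" "\<delta> = 0 \<or> \<delta> = 1" using assms by auto
  then show ?thesis
    unfolding AA_pow nested_diag(2)[OF d assms(1,3,2,4)]
    using assms by (auto simp: dsum_index[OF c] valid_def)
qed

lemma AA_carrier: "AA N \<alpha> m z \<in> carrier_mat (2 * h) (2 * h)"
  unfolding AA_def
proof (rule nested_diag(1))
  fix r
  have "- (jordan_block (\<alpha> r) z)\<^sup>T \<in> carrier_mat (\<alpha> r) (\<alpha> r)" by auto
  then show "jordan_block (\<alpha> r) z \<oplus>\<^sub>m - (jordan_block (\<alpha> r) z)\<^sup>T \<in> carrier_mat (2 * \<alpha> r) (2 * \<alpha> r)"
    using dsum_carrier[OF jordan_block_carrier] by (simp add: mult_2)
qed

text \<open>\<open>f(t) = z + t\<close> and \<open>g(t) = - z - t\<close>.\<close>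
lemma reindex_AA:
  "reindex (2 * h) reorder (AA N \<alpha> m z) =
     shift_series (\<lambda>d. if d = 0 then z else if d = 1 then 1 else 0) \<oplus>\<^sub>m
     (shift_series (\<lambda>d. if d = 0 then - z else if d = 1 then - 1 else 0))\<^sup>T"
proof (rule reindex_reorder_shift_series)
  fix r a p s b q \<epsilon> \<delta> :: nat assume *: "valid r a p" "valid s b q" "\<epsilon> < 2" "\<delta> < 2"
  have "AA N \<alpha> m z ^\<^sub>m 1 = AA N \<alpha> m z" using AA_carrier by simp
  with AA_pow_index[OF *, of z 1] *
  show "AA N \<alpha> m z $$ (chain_idx r p \<epsilon> a, chain_idx s q \<delta> b) = (if r = s \<and> p = q \<and> \<epsilon> = \<delta> then
         if \<epsilon> = 0 then if a \<le> b then if b - a = 0 then z else if b - a = 1 then 1 else 0 else 0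
         else if b \<le> a then if a - b = 0 then - z else if a - b = 1 then - 1 else 0 else 0 else 0)"
    by (auto simp: valid_def)
qed

lemma RR_carrier: "RR N \<alpha> m z \<in> carrier_mat (2 * h) (2 * h)"
  unfolding RR_def mat_exp_def carrier_matD[OF AA_carrier] by (rule mat_carrier)

text \<open>\<open>f(t) = exp (z + t)\<close> and \<open>g(t) = exp (- z - t)\<close>.\<close>
lemma reindex_RR:
  "reindex (2 * h) reorder (RR N \<alpha> m z) =
     shift_series (\<lambda>d. exp z / fact d) \<oplus>\<^sub>m (shift_series (\<lambda>d. (-1) ^ d * exp (- z) / fact d))\<^sup>T"
proof (rule reindex_reorder_shift_series)
  fix r a p s b q \<epsilon> \<delta> :: nat assume *: "valid r a p" "valid s b q" "\<epsilon> < 2" "\<delta> < 2"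
  let ?v = "if r = s \<and> p = q \<and> \<epsilon> = \<delta> then
      if \<epsilon> = 0 then if a \<le> b then exp z / fact (b - a) else 0
      else if b \<le> a then (-1) ^ (a - b) * exp (- z) / fact (a - b) else 0 else 0"
  have "(\<lambda>k. (AA N \<alpha> m z ^\<^sub>m k) $$ (chain_idx r p \<epsilon> a, chain_idx s q \<delta> b) / fact k) sums ?v"
    unfolding AA_pow_index[OF *]
    using * jordan_block_pow_exp_sums[of a "\<alpha> r" b z] neg_transpose_jordan_block_pow_exp_sums[of a "\<alpha> r" b z]
    by (auto simp: valid_def)
  then show "RR N \<alpha> m z $$ (chain_idx r p \<epsilon> a, chain_idx s q \<delta> b) = ?v"
    using chain_idx_less[OF *(1,3)] chain_idx_less[OF *(2,4)] carrier_matD[OF AA_carrier]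
    by (simp add: RR_def mat_exp_def sums_iff)
qed

lemma HH_carrier: "HH c N \<alpha> m \<in> carrier_mat (2 * h) (2 * h)"
  unfolding HH_def by (rule nested_diag(1)) (auto simp: mult_2)

lemma reindex_HH:
  "reindex (2 * h) reorder (HH c N \<alpha> m) =
     four_block_mat (0\<^sub>m h h) (1\<^sub>m h) ((-1) ^ (c + 1) \<cdot>\<^sub>m 1\<^sub>m h) (0\<^sub>m h h)"
proof (rule reindex_reorder_four_block)
  fix r a p s b q assume *: "valid r a p" "valid s b q"
  have d: "four_block_mat (0\<^sub>m (\<alpha> r) (\<alpha> r)) (1\<^sub>m (\<alpha> r))
        ((-1) ^ (c + 1) \<cdot>\<^sub>m 1\<^sub>m (\<alpha> r)) (0\<^sub>m (\<alpha> r) (\<alpha> r)) \<in> carrier_mat (2 * \<alpha> r) (2 * \<alpha> r)" for r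
    by (auto simp: mult_2)
  show "HH c N \<alpha> m $$ (chain_idx r p 0 a, chain_idx s q 0 b) = 0\<^sub>m h h $$ (block_idx r a p, block_idx s b q) \<and>
    HH c N \<alpha> m $$ (chain_idx r p 0 a, chain_idx s q 1 b) = 1\<^sub>m h $$ (block_idx r a p, block_idx s b q) \<and>
    HH c N \<alpha> m $$ (chain_idx r p 1 a, chain_idx s q 0 b) = ((-1) ^ (c + 1) \<cdot>\<^sub>m 1\<^sub>m h) $$ (block_idx r a p, block_idx s b q) \<and>
    HH c N \<alpha> m $$ (chain_idx r p 1 a, chain_idx s q 1 b) = 0\<^sub>m h h $$ (block_idx r a p, block_idx s b q)"
  proof -
    define \<sigma> :: complex where "\<sigma> = (-1) ^ (c + 1)"
    have n: "HH c N \<alpha> m $$ (chain_idx r p \<epsilon> a, chain_idx s q \<delta> b) = (if r = s \<and> p = q then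
        four_block_mat (0\<^sub>m (\<alpha> r) (\<alpha> r)) (1\<^sub>m (\<alpha> r)) (\<sigma> \<cdot>\<^sub>m 1\<^sub>m (\<alpha> r)) (0\<^sub>m (\<alpha> r) (\<alpha> r)) $$
          (\<epsilon> * \<alpha> r + a, \<delta> * \<alpha> r + b) else 0)" if "\<epsilon> < 2" "\<delta> < 2" for \<epsilon> \<delta>
      unfolding HH_def \<sigma>_def by (rule nested_diag(2)[OF d *(1) that(1) *(2) that(2)])
    show ?thesis
      unfolding \<sigma>_def[symmetric] using * n[of 0 0] n[of 0 1] n[of 1 0] n[of 1 1]
        block_idx_less[OF *(1)] block_idx_less[OF *(2)] block_idx_eq_iff[OF *]
      by (auto simp: valid_def)
  qed
qed auto

section \<open>Isometries that commute with the normal forms\<close>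

text \<open>For block diagonal matrices, preserving the form means that the second block is the inverse
  transpose of the first; the sign that separates the orthogonal from the symplectic case does not
  affect this.\<close>
lemma dsum_isometry:
  assumes X: "X \<in> carrier_mat h h" and W: "W \<in> carrier_mat h h"
  shows "(X \<oplus>\<^sub>m W)\<^sup>T * four_block_mat (0\<^sub>m h h) (1\<^sub>m h) (\<sigma> \<cdot>\<^sub>m 1\<^sub>m h) (0\<^sub>m h h) * (X \<oplus>\<^sub>m W) =
    four_block_mat (0\<^sub>m h h) (X\<^sup>T * W) (\<sigma> \<cdot>\<^sub>m (W\<^sup>T * X)) (0\<^sub>m h h)"
proof -
  have t: "X\<^sup>T \<in> carrier_mat h h" "W\<^sup>T \<in> carrier_mat h h" using X W by auto
  have 1: "(X \<oplus>\<^sub>m W)\<^sup>T * four_block_mat (0\<^sub>m h h) (1\<^sub>m h) (\<sigma> \<cdot>\<^sub>m 1\<^sub>m h) (0\<^sub>m h h) =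
      four_block_mat (0\<^sub>m h h) X\<^sup>T (\<sigma> \<cdot>\<^sub>m W\<^sup>T) (0\<^sub>m h h)"
    unfolding dsum_four_block[OF X W] using X W t
    by (simp add: transpose_four_block_mat[of _ h h _ h _ h]
        mult_four_block_mat[of _ h h _ h _ h _ _ h _ h] mult_smult_distrib[of _ h h _ h])
  show ?thesis
    unfolding 1 unfolding dsum_four_block[OF X W] using X W t
    by (simp add: mult_four_block_mat[of _ h h _ h _ h _ _ h _ h] mult_smult_assoc_mat[of _ h h _ h])
qed

end

context decreasing_block_sizes begin

text \<open>The right-hand side does not depend on \<open>B\<close>: every matrix that the reordering turns into
  \<open>f(N) \<oplus> g(N)\<^sup>T\<close> with \<open>f 0 \<noteq> g 0\<close> and \<open>f 1 \<noteq> 0\<close> has the same stabilizer. Applied to the normal form and to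
  its exponential, this gives both their coincidence and their conjugacy to the group.\<close>
lemma stabilizer_eq_XX:
  assumes B: "B \<in> carrier_mat (2 * h) (2 * h)"
    and BL: "reindex (2 * h) reorder B = shift_series f \<oplus>\<^sub>m (shift_series g)\<^sup>T"
    and f0: "f 0 \<noteq> g 0" and f1: "f 1 \<noteq> 0"
  shows "reindex (2 * h) reorder ` {Q \<in> {R \<in> carrier (GL (2 * h)). R\<^sup>T * HH c N \<alpha> m * R = HH c N \<alpha> m}.
      GL_inv (2 * h) Q * B * Q = B} = XX N \<alpha> m" (is "?re ` ?S = _")
proof -
  let ?H = "HH c N \<alpha> m" and ?s = "(-1) ^ (c + 1) :: complex"
  let ?F = "four_block_mat (0\<^sub>m h h) (1\<^sub>m h) (?s \<cdot>\<^sub>m 1\<^sub>m h) (0\<^sub>m h h)"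
  note bij = reorder_bij
  have Lt: "(shift_series g)\<^sup>T \<in> carrier_mat h h" by simp
  \<comment> \<open>The reordering preserves products, transposes and inverses, so membership can be tested after it.\<close>
  have mem: "Q \<in> ?S \<longleftrightarrow> ?re Q \<in> carrier (GL (2 * h)) \<and> (?re Q)\<^sup>T * ?F * ?re Q = ?F \<and>
      (shift_series f \<oplus>\<^sub>m (shift_series g)\<^sup>T) * ?re Q = ?re Q * (shift_series f \<oplus>\<^sub>m (shift_series g)\<^sup>T)" if Q: "Q \<in> carrier_mat (2 * h) (2 * h)" for Q
  proof -
    have 1: "Q\<^sup>T * ?H * Q = ?H \<longleftrightarrow> (?re Q)\<^sup>T * ?F * ?re Q = ?F"
    proof -
      have "?re (Q\<^sup>T * ?H * Q) = (?re Q)\<^sup>T * ?F * ?re Q"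
      proof -
        have t: "Q\<^sup>T \<in> carrier_mat (2 * h) (2 * h)" using Q by simp
        show ?thesis
          unfolding reindex_mult[OF bij mult_carrier_mat[OF t HH_carrier] Q] reindex_mult[OF bij t HH_carrier]
            reindex_transpose[OF bij Q] reindex_HH ..
      qed
      note e = this
      have k: "Q\<^sup>T * ?H * Q \<in> carrier_mat (2 * h) (2 * h)" 
        using mult_carrier_mat[OF mult_carrier_mat[OF _ HH_carrier[of c]] Q, of "Q\<^sup>T"] Q by simp
      show ?thesis using reindex_inject[OF bij k HH_carrier[of c]] unfolding e reindex_HH by (rule sym)
    qed
    have 2: "B * Q = Q * B \<longleftrightarrow> (shift_series f \<oplus>\<^sub>m (shift_series g)\<^sup>T) * ?re Q = ?re Q * (shift_series f \<oplus>\<^sub>m (shift_series g)\<^sup>T)"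
      using reindex_inject[OF bij mult_carrier_mat[OF B Q] mult_carrier_mat[OF Q B]]
      unfolding reindex_mult[OF bij B Q] reindex_mult[OF bij Q B] BL by (rule sym)
    have 3: "?re Q \<in> carrier (GL (2 * h)) \<longleftrightarrow> Q \<in> carrier (GL (2 * h))" by (rule reindex_GL[OF bij Q])
    have 4: "GL_inv (2 * h) Q * B * Q = B \<longleftrightarrow> B * Q = Q * B" if "Q \<in> carrier (GL (2 * h))"
      by (rule GL_conj_fixes_iff_commutes[OF that B])
    show ?thesis unfolding 3 1[symmetric] 2[symmetric] using 4 by auto
  qed
  show ?thesis
  proof
    show "?re ` ?S \<subseteq> XX N \<alpha> m"
    proof
      fix M assume "M \<in> ?re ` ?S"
      then obtain Q where Q: "Q \<in> ?S" "M = ?re Q" by blast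
      have "Q \<in> carrier (GL (2 * h))" using Q(1) by simp
      from mem[OF GL_carrier[OF this]] Q have M: "M \<in> carrier (GL (2 * h))" "M\<^sup>T * ?F * M = ?F"
        "(shift_series f \<oplus>\<^sub>m (shift_series g)\<^sup>T) * M = M * (shift_series f \<oplus>\<^sub>m (shift_series g)\<^sup>T)" by blast+
      have Mc: "M \<in> carrier_mat (h + h) (h + h)" using GL_carrier[OF M(1)] by (simp add: mult_2)
      obtain X Y Z W where split: "split_block M h h = (X, Y, Z, W)" by (metis prod_cases4)
      have car: "X \<in> carrier_mat h h" "Y \<in> carrier_mat h h" "Z \<in> carrier_mat h h" "W \<in> carrier_mat h h"
        and M4: "M = four_block_mat X Y Z W"
        using split_block[OF split, of h h] Mc by auto
      \<comment> \<open>The commutation relation leaves only the diagonal blocks, the isometry relation links them.\<close>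
      note cs = commutant_block_diagonal[OF car f0 f1 M(3)[unfolded M4]]
      have MXW: "M = X \<oplus>\<^sub>m W" using M4 cs dsum_four_block[OF car(1,4)] by simp
      have "four_block_mat (0\<^sub>m h h) (X\<^sup>T * W) (?s \<cdot>\<^sub>m (W\<^sup>T * X)) (0\<^sub>m h h) = ?F"
        using M(2) dsum_isometry[OF car(1,4), of ?s] MXW by simp
      then have ent: "four_block_mat (0\<^sub>m h h) (X\<^sup>T * W) (?s \<cdot>\<^sub>m (W\<^sup>T * X)) (0\<^sub>m h h) $$ (i, h + j) = ?F $$ (i, h + j)"
        for i j by simp
      have XW: "X\<^sup>T * W = 1\<^sub>m h"
      proof (rule eq_matI)
        fix i j assume "i < dim_row (1\<^sub>m h :: complex mat)" "j < dim_col (1\<^sub>m h :: complex mat)"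
        then show "(X\<^sup>T * W) $$ (i, j) = 1\<^sub>m h $$ (i, j)"
          using ent[of i j] car by (simp del: index_mult_mat(1))
      qed (use car in auto)
      have "X\<^sup>T \<in> carrier_mat h h" using car by simp
      note I = GL_I[OF this car(4) XW]
      have XG: "X \<in> carrier (GL h)" using GL_transpose(1)[OF I(1)] by simp
      have "W = (GL_inv h X)\<^sup>T" using GL_transpose(2)[OF XG] I(3) by simp
      moreover have "X \<in> TT N \<alpha> m" using XG cs(1) TT_iff by blast
      ultimately show "M \<in> XX N \<alpha> m" using MXW XX_I by simp
    qed
    show "XX N \<alpha> m \<subseteq> ?re ` ?S"
    proof
      fix M assume "M \<in> XX N \<alpha> m"
      then obtain X where X: "X \<in> TT N \<alpha> m" and M: "M = X \<oplus>\<^sub>m (GL_inv h X)\<^sup>T" by (auto simp: XX_def)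
      have XG: "X \<in> carrier (GL h)" and T: "block_toeplitz X" using X TT_iff by blast+
      note c = GL_carrier[OF XG] GL_inv(2)[OF XG]
      have Wc: "(GL_inv h X)\<^sup>T \<in> carrier_mat h h" using c by simp
      have MG: "M \<in> carrier (GL (2 * h))"
        using subgroup.subset[OF XX_subgroup] \<open>M \<in> XX N \<alpha> m\<close> by blast
      have 1: "X\<^sup>T * (GL_inv h X)\<^sup>T = 1\<^sub>m h"
        using transpose_mult[OF c(2,1)] GL_inv(4)[OF XG] by simp
      have 2: "((GL_inv h X)\<^sup>T)\<^sup>T * X = 1\<^sub>m h" using GL_inv(4)[OF XG] by simp
      have "M\<^sup>T * ?F * M = ?F" unfolding M dsum_isometry[OF c(1) Wc] 1 2 ..
      moreover have "(shift_series f \<oplus>\<^sub>m (shift_series g)\<^sup>T) * M = M * (shift_series f \<oplus>\<^sub>m (shift_series g)\<^sup>T)"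
      proof -
        have "(shift_series g)\<^sup>T * (GL_inv h X)\<^sup>T = (GL_inv h X)\<^sup>T * (shift_series g)\<^sup>T"
          using transpose_mult[OF c(2) shift_series_carrier, of g] transpose_mult[OF shift_series_carrier c(2), of g]
            block_toeplitz_imp_commutes[OF c(2) block_toeplitz_inv[OF XG T], of g] by metis
        then show ?thesis unfolding M dsum_mult[OF shift_series_carrier Lt c(1) Wc] dsum_mult[OF c(1) Wc shift_series_carrier Lt]
          using block_toeplitz_imp_commutes[OF c(1) T, of f] by simp
      qed
      moreover have "?re (reindex (2 * h) (inv_into {..<2 * h} reorder) M) = M"
        by (rule reindex_inverse(2)[OF bij GL_carrier[OF MG]])
      ultimately have "reindex (2 * h) (inv_into {..<2 * h} reorder) M \<in> ?S"
        unfolding mem[OF reindex_carrier] using MG by simp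
      then show "M \<in> ?re ` ?S"
        by (rule image_eqI[rotated]) (rule reindex_inverse(2)[OF bij GL_carrier[OF MG], symmetric])
    qed
  qed
qed

end

section \<open>Separately holomorphic functions of several variables\<close>

text \<open>Scalar version of the notion of holomorphic map; it is closed under the operations that occur
  in determinants and cofactors.\<close>
definition sep_holomorphic :: "'i set \<Rightarrow> ('i \<Rightarrow> complex) set \<Rightarrow> (('i \<Rightarrow> complex) \<Rightarrow> complex) \<Rightarrow> bool" where
  "sep_holomorphic I U \<phi> \<longleftrightarrow> continuous_map (subtopology (cspace I) U) euclidean \<phi> \<and>
     (\<forall>z\<in>U. \<forall>i\<in>I. (\<lambda>t. \<phi> (z(i := t))) holomorphic_on {t. z(i := t) \<in> U})"

lemma topspace_cspace: "topspace (cspace I) = extensional I"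
  by (simp add: cspace_def PiE_UNIV_domain PiE_def)

lemma holomorphic_mapI:
  assumes "\<And>j. j \<in> J \<Longrightarrow> sep_holomorphic I U (\<lambda>z. f z j)"
    and "\<And>z. z \<in> U \<Longrightarrow> f z \<in> extensional J"
  shows "holomorphic_map I J U f"
  unfolding holomorphic_map_def
proof (intro conjI ballI)
  show "continuous_map (subtopology (cspace I) U) (cspace J) f"
    unfolding cspace_def[of J]
    by (rule continuous_map_coordinatewise_then_product)
      (use assms in \<open>auto simp: sep_holomorphic_def extensional_def\<close>)
qed (use assms(1) in \<open>auto simp: sep_holomorphic_def\<close>)

lemma sep_holomorphic_const: "sep_holomorphic I U (\<lambda>_. c)"
  by (simp add: sep_holomorphic_def)

lemma sep_holomorphic_coordinate:
  assumes "k \<in> I" shows "sep_holomorphic I U (\<lambda>z. z k)"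
  unfolding sep_holomorphic_def
proof (intro conjI ballI)
  show "continuous_map (subtopology (cspace I) U) euclidean (\<lambda>z. z k)"
    unfolding cspace_def
    by (rule continuous_map_from_subtopology) (rule continuous_map_product_coordinates[OF assms])
  fix z i
  show "(\<lambda>t. (z(i := t)) k) holomorphic_on {t. z(i := t) \<in> U}"
    by (cases "i = k") simp_all
qed

lemma sep_holomorphic_mult:
  assumes "sep_holomorphic I U \<phi>" "sep_holomorphic I U \<psi>"
  shows "sep_holomorphic I U (\<lambda>z. \<phi> z * \<psi> z)"
  using assms unfolding sep_holomorphic_def
  by (auto intro!: holomorphic_on_mult simp: continuous_map_atin tendsto_mult)

lemma sep_holomorphic_sum:
  assumes "\<And>a. a \<in> A \<Longrightarrow> sep_holomorphic I U (\<phi> a)"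
  shows "sep_holomorphic I U (\<lambda>z. \<Sum>a\<in>A. \<phi> a z)"
  using assms unfolding sep_holomorphic_def
  by (auto intro!: holomorphic_on_sum tendsto_sum simp: continuous_map_atin)

lemma sep_holomorphic_prod:
  assumes "\<And>a. a \<in> A \<Longrightarrow> sep_holomorphic I U (\<phi> a)"
  shows "sep_holomorphic I U (\<lambda>z. \<Prod>a\<in>A. \<phi> a z)"
  using assms unfolding sep_holomorphic_def
  by (auto intro!: holomorphic_on_prod tendsto_prod simp: continuous_map_atin)

lemma sep_holomorphic_inverse:
  assumes "sep_holomorphic I U \<phi>" "\<And>z. z \<in> U \<Longrightarrow> \<phi> z \<noteq> 0"
  shows "sep_holomorphic I U (\<lambda>z. inverse (\<phi> z))"
  using assms unfolding sep_holomorphic_def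
  by (auto intro!: holomorphic_on_inverse tendsto_inverse simp: continuous_map_atin)

lemma sep_holomorphic_det:
  assumes "\<And>z. A z \<in> carrier_mat n n"
    and "\<And>i j. i < n \<Longrightarrow> j < n \<Longrightarrow> sep_holomorphic I U (\<lambda>z. A z $$ (i, j))"
  shows "sep_holomorphic I U (\<lambda>z. Determinant.det (A z))"
  unfolding det_def'[OF assms(1)]
  by (intro sep_holomorphic_sum sep_holomorphic_mult sep_holomorphic_const sep_holomorphic_prod assms(2))
    (auto dest: permutes_in_image)

lemma sep_holomorphic_adj_mat:
  assumes A: "\<And>z. A z \<in> carrier_mat n n"
    and "\<And>i j. i < n \<Longrightarrow> j < n \<Longrightarrow> sep_holomorphic I U (\<lambda>z. A z $$ (i, j))"
    and "i < n" "j < n"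
  shows "sep_holomorphic I U (\<lambda>z. adj_mat (A z) $$ (i, j))"
proof -
  have "sep_holomorphic I U (\<lambda>z. Determinant.det (mat_delete (A z) j i))"
  proof (rule sep_holomorphic_det)
    show "mat_delete (A z) j i \<in> carrier_mat (n - 1) (n - 1)" for z
      by (rule mat_delete_carrier[OF A])
    fix k l assume kl: "k < n - 1" "l < n - 1"
    have "(\<lambda>z. mat_delete (A z) j i $$ (k, l)) =
        (\<lambda>z. A z $$ (if k < j then k else Suc k, if l < i then l else Suc l))"
      using carrier_matD[OF A] kl by (intro ext) (simp add: mat_delete_def)
    then show "sep_holomorphic I U (\<lambda>z. mat_delete (A z) j i $$ (k, l))"
      using kl assms(2) by simp
  qed
  then have "sep_holomorphic I U (\<lambda>z. (-1) ^ (j + i) * Determinant.det (mat_delete (A z) j i))"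
    by (intro sep_holomorphic_mult sep_holomorphic_const)
  moreover have "(\<lambda>z. adj_mat (A z) $$ (i, j)) = (\<lambda>z. (-1) ^ (j + i) * Determinant.det (mat_delete (A z) j i))"
    using carrier_matD[OF A] assms(3,4) by (intro ext) (simp add: adj_mat_def cofactor_def)
  ultimately show ?thesis by simp
qed

section \<open>The dimension of the group\<close>

text \<open>The matrices \<open>X v\<close> fill their entries with zeros and coordinates of \<open>v\<close> according to the pattern \<open>w\<close>,
  and each coordinate occurs. So one chart suffices: the coordinates are read off from entries of
  the first block, the condition that \<open>X v\<close> is nonsingular is open in \<open>v\<close>, and the second block is
  rational in \<open>v\<close> by Cramer's rule.\<close>
lemma has_complex_dim_coordinate_pattern:
  fixes w :: "nat \<Rightarrow> nat \<Rightarrow> nat option" and h d :: nat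
  defines "X \<equiv> \<lambda>v. Matrix.mat h h (\<lambda>(i, j). case w i j of None \<Rightarrow> 0 | Some k \<Rightarrow> v k)"
  assumes w: "\<And>i j k. i < h \<Longrightarrow> j < h \<Longrightarrow> w i j = Some k \<Longrightarrow> k < d"
    and surj: "\<And>k. k < d \<Longrightarrow> \<exists>i<h. \<exists>j<h. w i j = Some k"
  shows "has_complex_dim (2 * h)
    {X v \<oplus>\<^sub>m (GL_inv h (X v))\<^sup>T | v. v \<in> extensional {..<d} \<and> X v \<in> carrier (GL h)} d"
proof -
  let ?I = "{..<2 * h} \<times> {..<2 * h}"
  let ?Q = "\<lambda>v. X v \<oplus>\<^sub>m (GL_inv h (X v))\<^sup>T"
  define V where "V = {v \<in> extensional {..<d}. X v \<in> carrier (GL h)}"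
  define g where "g v = mat_entries (2 * h) (?Q v)" for v
  have S: "{?Q v | v. v \<in> extensional {..<d} \<and> X v \<in> carrier (GL h)} = ?Q ` V"
    by (auto simp: V_def)
  have Xc: "X v \<in> carrier_mat h h" for v by (simp add: X_def)
  have Xij: "X v $$ (i, j) = (case w i j of None \<Rightarrow> 0 | Some k \<Rightarrow> v k)" if "i < h" "j < h" for v i j
    using that by (simp add: X_def)
  have Qc: "?Q v \<in> carrier_mat (2 * h) (2 * h)" if "v \<in> V" for v
    using that dsum_carrier[OF Xc[of v], of "(GL_inv h (X v))\<^sup>T" h] GL_inv(2)[of "X v" h] by (simp add: V_def mult_2)
  have Xhol: "sep_holomorphic {..<d} W (\<lambda>v. X v $$ (i, j))" if "i < h" "j < h" for W i j
    unfolding Xij[OF that]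
    by (cases "w i j") (use w that in \<open>auto intro: sep_holomorphic_const sep_holomorphic_coordinate\<close>)
  have dethol: "sep_holomorphic {..<d} W (\<lambda>v. Determinant.det (X v))" for W
    using Xc Xhol by (rule sep_holomorphic_det)
  have V_det: "V = {v \<in> topspace (cspace {..<d}). Determinant.det (X v) \<in> - {0}}"
    using GL_iff_det[OF Xc] by (auto simp: V_def topspace_cspace)
  have "continuous_map (cspace {..<d}) euclidean (\<lambda>v. Determinant.det (X v))"
    using dethol[of "topspace (cspace {..<d})"] by (simp add: sep_holomorphic_def)
  then have V_open: "openin (cspace {..<d}) V"
    unfolding V_det by (rule openin_continuous_map_preimage) (simp add: open_Compl)
  have ghol: "holomorphic_map {..<d} ?I V g"
  proof (rule holomorphic_mapI)
    show "g v \<in> extensional ?I" for v by (simp add: g_def mat_entries_def)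
    fix ij assume "ij \<in> ?I"
    then obtain i j where ij: "ij = (i, j)" "i < 2 * h" "j < 2 * h" by auto
    have gij: "g v ij = (if i < h then if j < h then X v $$ (i, j) else 0
        else if j < h then 0 else inverse (Determinant.det (X v)) * adj_mat (X v) $$ (j - h, i - h))"
      if "v \<in> V" for v
    proof -
      have G: "X v \<in> carrier (GL h)" using that by (simp add: V_def)
      have c: "(GL_inv h (X v))\<^sup>T \<in> carrier_mat h h" using GL_inv(2)[OF G] by simp
      have "g v ij = ?Q v $$ (i, j)" using ij by (simp add: g_def mat_entries_def)
      also have "\<dots> = (if i < h then if j < h then X v $$ (i, j) else 0
        else if j < h then 0 else (GL_inv h (X v))\<^sup>T $$ (i - h, j - h))"
        using ij by (intro dsum_index[OF Xc c]) auto
      finally show ?thesis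
        using ij adj_mat(1)[OF Xc[of v]] by (auto simp: GL_inv_adj_mat[OF G])
    qed
    have hol: "sep_holomorphic {..<d} V (\<lambda>v. if i < h then if j < h then X v $$ (i, j) else 0
        else if j < h then 0 else inverse (Determinant.det (X v)) * adj_mat (X v) $$ (j - h, i - h))"
    proof -
      have "sep_holomorphic {..<d} V (\<lambda>v. inverse (Determinant.det (X v)) * adj_mat (X v) $$ (j - h, i - h))"
        if "\<not> i < h" "\<not> j < h"
      proof (intro sep_holomorphic_mult sep_holomorphic_inverse dethol)
        show "sep_holomorphic {..<d} V (\<lambda>v. adj_mat (X v) $$ (j - h, i - h))"
          by (rule sep_holomorphic_adj_mat[OF Xc Xhol]) (use that ij in auto)
      qed (use V_det in auto)
      then show ?thesis using Xhol[of i j V] sep_holomorphic_const[of "{..<d}" V 0]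
        by (cases "i < h"; cases "j < h") simp_all
    qed
    show "sep_holomorphic {..<d} V (\<lambda>v. g v ij)"
      unfolding sep_holomorphic_def
    proof (intro conjI ballI)
      show "continuous_map (subtopology (cspace {..<d}) V) euclidean (\<lambda>v. g v ij)"
        by (rule continuous_map_eq[OF hol[unfolded sep_holomorphic_def, THEN conjunct1]])
          (simp add: gij)
      fix z k assume "z \<in> V" "k \<in> {..<d}"
      with hol have "(\<lambda>t. if i < h then if j < h then X (z(k := t)) $$ (i, j) else 0
        else if j < h then 0 else inverse (Determinant.det (X (z(k := t)))) * adj_mat (X (z(k := t))) $$ (j - h, i - h))
        holomorphic_on {t. z(k := t) \<in> V}" unfolding sep_holomorphic_def by blast
      then show "(\<lambda>t. g (z(k := t)) ij) holomorphic_on {t. z(k := t) \<in> V}"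
        by (rule holomorphic_transform) (simp add: gij)
    qed
  qed
  obtain I J where IJ: "\<And>k. k < d \<Longrightarrow> I k < h \<and> J k < h \<and> w (I k) (J k) = Some k"
    using surj by metis
  define F where "F \<xi> = restrict (\<lambda>k. \<xi> (I k, J k)) {..<d}" for \<xi> :: "nat \<times> nat \<Rightarrow> complex"
  have Fhol: "holomorphic_map ?I {..<d} (topspace (cspace ?I)) F"
  proof (rule holomorphic_mapI)
    fix k assume "k \<in> {..<d}"
    then have "(I k, J k) \<in> ?I" "(\<lambda>\<xi>. F \<xi> k) = (\<lambda>\<xi>. \<xi> (I k, J k))" using IJ[of k] by (auto simp: F_def)
    then show "sep_holomorphic ?I (topspace (cspace ?I)) (\<lambda>\<xi>. F \<xi> k)"
      by (simp add: sep_holomorphic_coordinate)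
  qed (simp add: F_def)
  have Fg: "F (g v) = v" if "v \<in> V" for v
  proof (rule extensionalityI[of _ "{..<d}"])
    show "v \<in> extensional {..<d}" using that by (simp add: V_def)
    fix k assume "k \<in> {..<d}"
    then have k: "k < d" "I k < h" "J k < h" "w (I k) (J k) = Some k" using IJ[of k] by auto
    have G: "X v \<in> carrier (GL h)" using that by (simp add: V_def)
    have c: "(GL_inv h (X v))\<^sup>T \<in> carrier_mat h h" using GL_inv(2)[OF G] by simp
    show "F (g v) k = v k"
      using k by (simp add: F_def g_def mat_entries_def dsum_index[OF Xc c] Xij)
  qed (simp add: F_def)
  have image: "mat_entries (2 * h) ` ?Q ` V = g ` V" by (auto simp: g_def)
  have sub: "g ` V \<subseteq> topspace (cspace ?I)"
    by (auto simp: g_def mat_entries_def topspace_cspace)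
  show ?thesis
    unfolding has_complex_dim_def S image complex_submanifold_def
  proof (intro conjI ballI sub)
    show "?Q ` V \<subseteq> carrier_mat (2 * h) (2 * h)" using Qc by auto
    fix \<xi> assume "\<xi> \<in> g ` V"
    then show "\<exists>U V' F g'. openin (cspace ?I) U \<and> \<xi> \<in> U \<and> openin (cspace {..<d}) V' \<and>
        holomorphic_map ?I {..<d} U F \<and> holomorphic_map {..<d} ?I V' g' \<and>
        g' ` V' = g ` V \<inter> U \<and> (\<forall>v\<in>V'. F (g' v) = v)"
      using sub V_open Fhol ghol Fg
      by (intro exI[of _ "topspace (cspace ?I)"] exI[of _ V] exI[of _ F] exI[of _ g]) auto
  qed
qed

text \<open>The number of free coefficients: the block \<open>(r, s)\<close> has \<open>min (\<alpha> r) (\<alpha> s)\<close> of them, each a matrix of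
  size \<open>m r\<close> times \<open>m s\<close>. As the sizes decrease, the minimum is the one with the larger index.\<close>
lemma sum_min_decreasing:
  fixes \<alpha> m :: "nat \<Rightarrow> nat"
  assumes "\<And>r s. r < s \<Longrightarrow> s < N \<Longrightarrow> \<alpha> s < \<alpha> r"
  shows "(\<Sum>r<N. \<Sum>s<N. min (\<alpha> r) (\<alpha> s) * (m r * m s)) =
    (\<Sum>r<N. m r * (\<alpha> r * m r + 2 * (\<Sum>s<r. \<alpha> r * m s)))"
  using assms
proof (induction N)
  case (Suc N)
  have 1: "min (\<alpha> r) (\<alpha> N) = \<alpha> N" "min (\<alpha> N) (\<alpha> r) = \<alpha> N" if "r < N" for r
    using Suc.prems[of r N] that by auto
  have "(\<Sum>r<Suc N. \<Sum>s<Suc N. min (\<alpha> r) (\<alpha> s) * (m r * m s)) =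
      (\<Sum>r<N. \<Sum>s<N. min (\<alpha> r) (\<alpha> s) * (m r * m s)) + (\<Sum>r<N. min (\<alpha> r) (\<alpha> N) * (m r * m N)) +
      (\<Sum>s<N. min (\<alpha> N) (\<alpha> s) * (m N * m s)) + \<alpha> N * (m N * m N)"
    by (simp add: sum.distrib)
  also have "(\<Sum>r<N. min (\<alpha> r) (\<alpha> N) * (m r * m N)) = m N * (\<Sum>s<N. \<alpha> N * m s)"
    unfolding sum_distrib_left by (intro sum.cong) (auto simp: 1)
  also have "(\<Sum>s<N. min (\<alpha> N) (\<alpha> s) * (m N * m s)) = m N * (\<Sum>s<N. \<alpha> N * m s)"
    unfolding sum_distrib_left by (intro sum.cong) (auto simp: 1)
  also have "(\<Sum>r<N. \<Sum>s<N. min (\<alpha> r) (\<alpha> s) * (m r * m s)) =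
    (\<Sum>r<N. m r * (\<alpha> r * m r + 2 * (\<Sum>s<r. \<alpha> r * m s)))"
    by (rule Suc.IH) (use Suc.prems in auto)
  finally show ?case by (simp add: algebra_simps)
qed simp

context decreasing_block_sizes begin

lemma XX_dim:
  "has_complex_dim (2 * h) (XX N \<alpha> m) (\<Sum>r<N. m r * (\<alpha> r * m r + 2 * (\<Sum>s<r. \<alpha> r * m s)))"
proof -
  define E where "E = (SIGMA r:{..<N}. SIGMA s:{..<N}. {..<min (\<alpha> r) (\<alpha> s)} \<times> {..<m r} \<times> {..<m s})"
  define d where "d = card E"
  have fin: "finite E" by (simp add: E_def)
  have d: "d = (\<Sum>r<N. m r * (\<alpha> r * m r + 2 * (\<Sum>s<r. \<alpha> r * m s)))"
    using sum_min_decreasing[where N = N and \<alpha> = \<alpha> and m = m, OF \<alpha>_decr]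
    by (simp add: d_def E_def card_SigmaI)
  obtain \<beta> where \<beta>: "bij_betw \<beta> E {..<d}"
    using ex_bij_betw_finite_nat[OF fin] unfolding d_def lessThan_atLeast0 by blast
  \<comment> \<open>Entry pattern of block Toeplitz matrices: the offset of the diagonal selects the coefficient.\<close>
  define w where "w i j = (case block_coords i of (r, a, p) \<Rightarrow> case block_coords j of (s, b, q) \<Rightarrow>
    if a + (\<alpha> s - \<alpha> r) \<le> b then Some (\<beta> (r, s, b - a - (\<alpha> s - \<alpha> r), p, q)) else None)" for i j
  define X where "X v = Matrix.mat h h (\<lambda>(i, j). case w i j of None \<Rightarrow> 0 | Some k \<Rightarrow> v k)"
    for v :: "nat \<Rightarrow> complex"
  have w_block_idx: "w (block_idx r a p) (block_idx s b q) =
      (if a + (\<alpha> s - \<alpha> r) \<le> b then Some (\<beta> (r, s, b - a - (\<alpha> s - \<alpha> r), p, q)) else None)"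
    if "valid r a p" "valid s b q" for r a p s b q
    using that by (simp add: w_def block_coords_block_idx)
  have inE: "(r, s, b - a - (\<alpha> s - \<alpha> r), p, q) \<in> E"
    if "valid r a p" "valid s b q" "a + (\<alpha> s - \<alpha> r) \<le> b" for r a p s b q
    using that by (auto simp: E_def valid_def)
  have X_block_idx: "X v $$ (block_idx r a p, block_idx s b q) =
      (if a + (\<alpha> s - \<alpha> r) \<le> b then v (\<beta> (r, s, b - a - (\<alpha> s - \<alpha> r), p, q)) else 0)"
    if "valid r a p" "valid s b q" for v r a p s b q
    using that by (simp add: X_def block_idx_less w_block_idx)
  have T: "block_toeplitz (X v)" for v
    unfolding block_toeplitz_def toeplitz_like_def
  proof (intro allI impI)
    fix r s p q a b assume "r < N" "s < N" "p < m r" "q < m s" "a < \<alpha> r" "b < \<alpha> s"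
    then have "valid r a p" "valid s b q" "valid r 0 p" "valid s (b - a) q" by (auto simp: valid_def)
    then show "X v $$ (block_idx r a p, block_idx s b q) =
        (if a + (\<alpha> s - \<alpha> r) \<le> b then X v $$ (block_idx r 0 p, block_idx s (b - a) q) else 0)"
      by (auto simp: X_block_idx)
  qed
  have onto: "\<exists>v \<in> extensional {..<d}. M = X v" if M: "M \<in> carrier_mat h h" "block_toeplitz M" for M
  proof
    \<comment> \<open>The coefficients are found in the first row of blocks, to the right of the zero padding.\<close>
    let ?c = "\<lambda>(r, s, t, p, q). M $$ (block_idx r 0 p, block_idx s (t + (\<alpha> s - \<alpha> r)) q)"
    let ?v = "restrict (\<lambda>k. ?c (inv_into E \<beta> k)) {..<d}"
    show "?v \<in> extensional {..<d}" by simp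
    show "M = X ?v"
    proof (rule mat_eqI_block_idx[OF M(1)])
      show "X ?v \<in> carrier_mat h h" by (simp add: X_def)
      fix r a p s b q assume *: "valid r a p" "valid s b q"
      have "toeplitz_like (\<alpha> r) (\<alpha> s) (\<lambda>a b. M $$ (block_idx r a p, block_idx s b q))"
        using M * by (auto simp: block_toeplitz_def valid_def)
      then have 1: "M $$ (block_idx r a p, block_idx s b q) =
          (if a + (\<alpha> s - \<alpha> r) \<le> b then M $$ (block_idx r 0 p, block_idx s (b - a) q) else 0)"
        using * unfolding toeplitz_like_def valid_def by blast
      show "M $$ (block_idx r a p, block_idx s b q) = X ?v $$ (block_idx r a p, block_idx s b q)"
      proof (cases "a + (\<alpha> s - \<alpha> r) \<le> b")
        case True
        have e: "(r, s, b - a - (\<alpha> s - \<alpha> r), p, q) \<in> E" using inE * True by blast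
        then have "\<beta> (r, s, b - a - (\<alpha> s - \<alpha> r), p, q) < d"
          "inv_into E \<beta> (\<beta> (r, s, b - a - (\<alpha> s - \<alpha> r), p, q)) = (r, s, b - a - (\<alpha> s - \<alpha> r), p, q)"
          using \<beta> by (auto simp: bij_betw_def)
        then show ?thesis unfolding X_block_idx[OF *] 1 using True by simp
      qed (simp add: 1 X_block_idx[OF *])
    qed
  qed
  have "XX N \<alpha> m = {X v \<oplus>\<^sub>m (GL_inv h (X v))\<^sup>T | v. v \<in> extensional {..<d} \<and> X v \<in> carrier (GL h)}"
  proof (intro equalityI subsetI)
    fix Q assume "Q \<in> XX N \<alpha> m"
    then obtain M where M: "M \<in> TT N \<alpha> m" "Q = M \<oplus>\<^sub>m (GL_inv h M)\<^sup>T" by (auto simp: XX_def)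
    have "M \<in> carrier (GL h)" "block_toeplitz M" using M TT_iff by blast+
    with onto[OF GL_carrier] obtain v where "v \<in> extensional {..<d}" "M = X v" by blast
    with M \<open>M \<in> carrier (GL h)\<close>
    show "Q \<in> {X v \<oplus>\<^sub>m (GL_inv h (X v))\<^sup>T | v. v \<in> extensional {..<d} \<and> X v \<in> carrier (GL h)}"
      by auto
  next
    fix Q assume "Q \<in> {X v \<oplus>\<^sub>m (GL_inv h (X v))\<^sup>T | v. v \<in> extensional {..<d} \<and> X v \<in> carrier (GL h)}"
    then show "Q \<in> XX N \<alpha> m" using T TT_iff XX_I by auto
  qed
  moreover have "has_complex_dim (2 * h)
      {X v \<oplus>\<^sub>m (GL_inv h (X v))\<^sup>T | v. v \<in> extensional {..<d} \<and> X v \<in> carrier (GL h)} d"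
    unfolding X_def
  proof (rule has_complex_dim_coordinate_pattern)
    fix i j k assume *: "i < h" "j < h" "w i j = Some k"
    obtain r a p where r: "valid r a p" "i = block_idx r a p" using *(1) by (rule block_idx_ex)
    obtain s b q where s: "valid s b q" "j = block_idx s b q" using *(2) by (rule block_idx_ex)
    have "a + (\<alpha> s - \<alpha> r) \<le> b" "k = \<beta> (r, s, b - a - (\<alpha> s - \<alpha> r), p, q)"
      using *(3) unfolding r(2) s(2) w_block_idx[OF r(1) s(1)] by (auto split: if_splits)
    then show "k < d" using inE[OF r(1) s(1)] \<beta> by (auto simp: bij_betw_def)
  next
    fix k assume "k < d"
    then have "k \<in> \<beta> ` E" using \<beta> by (simp add: bij_betw_def)
    then obtain e where "e \<in> E" "k = \<beta> e" by blast
    moreover obtain r s t p q where "e = (r, s, t, p, q)" by (cases e) auto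
    ultimately have e: "(r, s, t, p, q) \<in> E" "k = \<beta> (r, s, t, p, q)" by auto
    then have *: "valid r 0 p" "valid s (t + (\<alpha> s - \<alpha> r)) q" by (auto simp: E_def valid_def)
    have "w (block_idx r 0 p) (block_idx s (t + (\<alpha> s - \<alpha> r)) q) = Some k"
      unfolding w_block_idx[OF *] using e by simp
    then show "\<exists>i<h. \<exists>j<h. w i j = Some k" using block_idx_less * by blast
  qed
  ultimately show ?thesis unfolding d by simp
qed

section \<open>Conjugacy of the isotropy groups\<close>

lemma conjugate_to_XX:
  assumes S: "S \<subseteq> carrier (GL (2 * h))" and "reindex (2 * h) reorder ` S = XX N \<alpha> m"
  shows "conjugate_sets (2 * h) S (XX N \<alpha> m)"
proof -
  obtain P where P: "P \<in> carrier (GL (2 * h))"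
    "\<And>M. M \<in> carrier_mat (2 * h) (2 * h) \<Longrightarrow> GL_inv (2 * h) P * M * P = reindex (2 * h) reorder M"
    by (rule perm_matrix[OF reorder_bij]) blast
  have "conj_image (2 * h) P S = reindex (2 * h) reorder ` S"
    unfolding conj_image_def using S GL_carrier by (intro image_cong refl P(2)) blast
  then show ?thesis using P(1) assms(2) unfolding conjugate_sets_def by metis
qed

end

text \<open>The excluded points are exactly those where the exponentials of the two opposite eigenvalues
  coincide.\<close>
lemma exp_eq_exp_minus_imp:
  fixes z :: complex
  assumes "exp z = exp (- z)" shows "\<exists>k :: int. z = \<i> * of_int k * of_real pi"
proof -
  obtain n :: int where "z = - z + of_real (of_int (2 * n) * pi) * \<i>"
    using assms unfolding exp_eq by (metis)
  then have "2 * z = 2 * (\<i> * of_int n * of_real pi)" by (simp add: algebra_simps)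
  then show ?thesis by auto
qed

theorem theorem2p6:
  fixes N n c :: nat and \<alpha> m :: "nat \<Rightarrow> nat"
    and H :: "complex mat" and G :: "complex mat set" and \<Lambda> :: "complex set"
  assumes "1 \<le> N"
    and "\<And>r. r < N \<Longrightarrow> 0 < \<alpha> r"
    and "\<And>r. r < N \<Longrightarrow> 0 < m r"
    and "\<And>r s. r < s \<Longrightarrow> s < N \<Longrightarrow> \<alpha> s < \<alpha> r"
    and "n = 2 * (\<Sum>r<N. \<alpha> r * m r)"
    and "c \<in> {1, 2}"
    and "H = HH c N \<alpha> m"
    and "G = (if c = 1 then O_group n H else Sp_group n H)"
    and "\<Lambda> = {\<i> * of_int k * of_real pi | k :: int. True}"
  shows
    "(\<forall>z. z \<notin> \<Lambda> \<longrightarrow> isotropy_group n G (AA N \<alpha> m z) = centralizer n G (RR N \<alpha> m z)) \<and>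
     (\<forall>z. z \<noteq> 0 \<longrightarrow> conjugate_sets n (isotropy_group n G (AA N \<alpha> m z)) (XX N \<alpha> m)) \<and>
     (\<forall>w. w \<notin> \<Lambda> \<longrightarrow> conjugate_sets n (centralizer n G (RR N \<alpha> m w)) (XX N \<alpha> m)) \<and>
     subgroup (XX N \<alpha> m) (GL n) \<and>
     (\<exists>F \<in> carrier (GL (half_dim N \<alpha> m)).
        conj_image n (1\<^sub>m (half_dim N \<alpha> m) \<oplus>\<^sub>m F) (XX N \<alpha> m) \<subseteq> TT_dsum N \<alpha> m) \<and>
     has_complex_dim n (XX N \<alpha> m)
       (\<Sum>r<N. m r * (\<alpha> r * m r + 2 * (\<Sum>s<r. \<alpha> r * m s)))"
proof -
  interpret decreasing_block_sizes N \<alpha> m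
    using assms(2,4) by unfold_locales
  have n: "n = 2 * h" using assms(5) by (simp add: half_dim_def)
  have G: "G = {R \<in> carrier (GL n). R\<^sup>T * HH c N \<alpha> m * R = HH c N \<alpha> m}"
    using assms(7,8) by (simp add: O_group_def Sp_group_def)
  have iso: "reindex n reorder ` isotropy_group n G (AA N \<alpha> m z) = XX N \<alpha> m" if "z \<noteq> 0" for z
    unfolding isotropy_group_def G n
  proof (rule stabilizer_eq_XX[OF AA_carrier reindex_AA])
    show "(if (0 :: nat) = 0 then z else if (0 :: nat) = 1 then 1 else 0) \<noteq>
        (if (0 :: nat) = 0 then - z else if (0 :: nat) = 1 then - 1 else 0)" using that by auto
  qed simp
  have cen: "reindex n reorder ` centralizer n G (RR N \<alpha> m z) = XX N \<alpha> m" if "z \<notin> \<Lambda>" for z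
    unfolding centralizer_def G n
  proof (rule stabilizer_eq_XX[OF RR_carrier reindex_RR])
    show "exp z / fact 0 \<noteq> (-1) ^ 0 * exp (- z) / fact 0"
      using that exp_eq_exp_minus_imp[of z] unfolding assms(9) by auto
  qed simp
  have sub: "isotropy_group n G A \<subseteq> carrier (GL n)" "centralizer n G A \<subseteq> carrier (GL n)" for A
    unfolding isotropy_group_def centralizer_def G by auto
  have "0 \<in> \<Lambda>" unfolding assms(9) by (auto intro!: exI[of _ 0])
  have "isotropy_group n G (AA N \<alpha> m z) = centralizer n G (RR N \<alpha> m z)" if "z \<notin> \<Lambda>" for z
  proof -
    have "z \<noteq> 0" using that \<open>0 \<in> \<Lambda>\<close> by auto
    have "inj_on (reindex n reorder) (carrier_mat n n)"
      using reindex_inject[OF reorder_bij] unfolding n by (auto intro!: inj_onI)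
    then show ?thesis
      using iso[OF \<open>z \<noteq> 0\<close>] cen[OF that] sub GL_carrier
      by (metis inj_on_image_eq_iff subset_iff)
  qed
  moreover have "conjugate_sets n (isotropy_group n G (AA N \<alpha> m z)) (XX N \<alpha> m)" if "z \<noteq> 0" for z
    using conjugate_to_XX[of "isotropy_group n G (AA N \<alpha> m z)"] sub(1) iso[OF that] unfolding n by blast
  moreover have "conjugate_sets n (centralizer n G (RR N \<alpha> m z)) (XX N \<alpha> m)" if "z \<notin> \<Lambda>" for z
    using conjugate_to_XX[of "centralizer n G (RR N \<alpha> m z)"] sub(2) cen[OF that] unfolding n by blast
  ultimately show ?thesis
    using XX_subgroup XX_conj_subset_TT_dsum XX_dim unfolding n by blast
qed

end
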